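(* In the setting of the context (half-space domains $\Omega_X,\Omega_Y$, weakly coupled dynamics $f(x)+a+Db$ for player $X$, decoupled dynamics $g(y,b)$ for player $Y$, separated running cost $\ell=\ell_1(x,y,a)+\ell_2(x,y,b)$), suppose that: (1) for every $x\in\partial\Omega_X$ there exist $a_1,a_2\in A$ such that, for all $b\in B$, $f(x)+a_1+Db$ is strictly entering in $\Omega_X$ and $f(x)+a_2+Db$ is strictly entering in $\mathbb{R}^n\setminus\overline\Omega_X$; (2) for every $y\in\partial\Omega_Y$ there exist $b_1,b_2\in B$ such that $g(y,b_1)$ is strictly entering in $\Omega_Y$ and $g(y,b_2)$ is strictly entering in $\mathbb{R}^m\setminus\overline\Omega_Y$. Then for every $T>0$ and every compact set $K=K^X\times K^Y$, with $K^X\subseteq\overline\Omega_X$ and $K^Y\subseteq\overline\Omega_Y$ compact, there exists a modulus of continuity $\mathcal{O}_{T,K}$ such that, for every $(x_1,y_1),(x_2,y_2)\in K$, there exist a non-anticipating tuning $\beta\mapsto\tilde\beta$ from $\mathcal{B}$ to itself and a way to associate to every $\gamma\in\Gamma$ some $\tilde{\tilde\gamma}\in\Gamma$ such that, for every $\beta\in\mathcal{B}$ and $\gamma\in\Gamma$, setting $\tilde\tau=\min\{\tau_X(x_2,\gamma[\tilde\beta],\tilde\beta),\tau_Y(y_1,\beta),T\}$: - $\tau_X(x_1,\tilde{\tilde\gamma}[\beta],\beta)\ge\tau_X(x_2,\gamma[\tilde\beta],\tilde\beta)$; - $\tau_Y(y_2,\tilde\beta)\ge\tau_Y(y_1,\beta)$;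 - $\|X(\tilde\tau;x_1,\tilde{\tilde\gamma}[\beta],\beta)-X(\tilde\tau;x_2,\gamma[\tilde\beta],\tilde\beta)\|\le\mathcal{O}_{T,K}(\|x_1-x_2\|+\|y_1-y_2\|)$; - $\|Y(\tilde\tau;y_1,\beta)-Y(\tilde\tau;y_2,\tilde\beta)\|\le\mathcal{O}_{T,K}(\|y_1-y_2\|)$; - $|J_{\tilde\tau}(x_1,y_1,\tilde{\tilde\gamma}[\beta],\beta)-J_{\tilde\tau}(x_2,y_2,\gamma[\tilde\beta],\tilde\beta)|\le\mathcal{O}_{T,K}(\|(x_1,y_1)-(x_2,y_2)\|)$.
   Context: **Data.** $\Omega_X\subset\mathbb{R}^n$ and $\Omega_Y\subset\mathbb{R}^m$ are open half-spaces, each bounded by a hyperplane through the origin. $A\subset\mathbb{R}^n$ and $B\subset\mathbb{R}^{m'}$ are compact, $D\in\mathbb{R}^{n\times m'}$ is a constant matrix with $DB=\{Db:b\in B\}\subseteq A$, and $\lambda>0$. $f:\mathbb{R}^n\to\mathbb{R}^n$ is bounded and Lipschitz continuous. $g:\mathbb{R}^m\times B\to\mathbb{R}^m$ is bounded, continuous, and Lipschitz continuous in $y$ uniformly in $b$. The running cost is $\ell(x,y,a,b)=\ell_1(x,y,a)+\ell_2(x,y,b)\ge0$, where $\ell_1,\ell_2$ are bounded, continuous, and Lipschitz continuous in $(x,y)$ uniformly with respect to $a$ and $b$ respectively. $\mathcal{A}$ (resp. $\mathcal{B}$) is the set of measurable functions $[0,+\infty[\to A$ (resp. $[0,+\infty[\to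 B$). **Strictly entering.** With $\eta$ the outer unit normal to the boundary of an open set $\Omega$ at a boundary point, a vector $v$ is strictly entering in $\Omega$ if $v\cdot\eta<0$, and strictly entering in the complement of $\overline\Omega$ if $v\cdot\eta>0$. **Trajectories.** $X(\cdot;x,\alpha,\beta)$ solves $X'(t)=f(X(t))+\alpha(t)+D\beta(t)$, $X(0)=x\in\overline\Omega_X$; $Y(\cdot;y,\beta)$ solves $Y'(t)=g(Y(t),\beta(t))$, $Y(0)=y\in\overline\Omega_Y$. Exit times (with $\inf\emptyset=+\infty$): $\tau_X(x,\alpha,\beta)=\inf\{t\ge0:X(t;x,\alpha,\beta)\notin\overline\Omega_X\}$, $\tau_Y(y,\beta)=\inf\{t\ge0:Y(t;y,\beta)\notin\overline\Omega_Y\}$. **Running cost up to time $\sigma$.** $J_\sigma(x,y,\alpha,\beta)=\int_0^\sigma e^{-\lambda t}\ell(X(t;x,\alpha,\beta),Y(t;y,\beta),\alpha(t),\beta(t))\,dt$. **Non-anticipating maps.** A map $u\mapsto\tilde u$ between sets of measurable functions on $[0,+\infty[$ is a non-anticipating tuning if for all $t\ge0$: $u_1=u_2$ a.e. in $[0,t]$ implies $\tilde u_1=\tilde u_2$ a.e. in $[0,t]$. $\Gamma$ is the set of non-anticipating tunings $\gamma:\mathcal{B}\to\mathcal{A}$, $\beta\mapsto\gamma[\beta]$ (non-anticipating strategies for player $X$). **Modulus of continuity.** An increasing continuous function $\omega:[0,+\infty[\to[0,+\infty[$ with $\omega(0)=0$. *)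

theory Defs
  imports "HOL-Analysis.Analysis"
begin

text \<open>Measurable controls on \<open>[0,\<infinity>[\<close> with values in \<open>U\<close>; extensionality makes them functions
  on the half-line only.\<close>

definition controls :: "'a::euclidean_space set \<Rightarrow> (real \<Rightarrow> 'a) set" where
  "controls U = ({0..} \<rightarrow>\<^sub>E U) \<inter> borel_measurable (lebesgue_on {0..})"

definition nonanticipating_tuning ::
    "(real \<Rightarrow> 'a) set \<Rightarrow> (real \<Rightarrow> 'b) set \<Rightarrow> ((real \<Rightarrow> 'a) \<Rightarrow> (real \<Rightarrow> 'b)) \<Rightarrow> bool" where
  "nonanticipating_tuning \<U> \<V> \<phi> \<longleftrightarrow>
     \<phi> \<in> \<U> \<rightarrow> \<V> \<and>
     (\<forall>t\<ge>0. \<forall>u1\<in>\<U>. \<forall>u2\<in>\<U>.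
        (AE s in lebesgue_on {0..t}. u1 s = u2 s) \<longrightarrow>
        (AE s in lebesgue_on {0..t}. \<phi> u1 s = \<phi> u2 s))"

definition strategies ::
    "'a::euclidean_space set \<Rightarrow> 'b::euclidean_space set \<Rightarrow> ((real \<Rightarrow> 'b) \<Rightarrow> (real \<Rightarrow> 'a)) set" where
  "strategies A B = {\<gamma>. nonanticipating_tuning (controls B) (controls A) \<gamma>}"

text \<open>Controls are merely measurable, so solutions are meant in the Caratheodory sense, i.e.
  they satisfy the integral equation on \<open>[0,\<infinity>[\<close>.\<close>

definition caratheodory_solution ::
    "(real \<Rightarrow> 'a \<Rightarrow> 'a) \<Rightarrow> 'a \<Rightarrow> (real \<Rightarrow> 'a::euclidean_space) \<Rightarrow> bool" where
  "caratheodory_solution F x0 Z \<longleftrightarrow>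
     (\<forall>t\<ge>0. set_integrable lebesgue {0..t} (\<lambda>s. F s (Z s)) \<and>
            Z t = x0 + (LINT s:{0..t}|lebesgue. F s (Z s)))"

text \<open>For right-hand sides that are Lipschitz in the state the solution exists and is unique on
  \<open>[0,\<infinity>[\<close>; its values at negative times are arbitrary and never used.\<close>

definition trajectory ::
    "(real \<Rightarrow> 'a \<Rightarrow> 'a) \<Rightarrow> 'a \<Rightarrow> (real \<Rightarrow> 'a::euclidean_space)" where
  "trajectory F x0 = (SOME Z. caratheodory_solution F x0 Z)"

definition trajX ::
    "(real^'n \<Rightarrow> real^'n) \<Rightarrow> real^'k^'n \<Rightarrow> real^'n \<Rightarrow> (real \<Rightarrow> real^'n) \<Rightarrow> (real \<Rightarrow> real^'k)
      \<Rightarrow> real \<Rightarrow> real^'n" where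
  "trajX f D x \<alpha> \<beta> = trajectory (\<lambda>s z. f z + \<alpha> s + D *v \<beta> s) x"

definition trajY ::
    "(real^'m \<Rightarrow> real^'k \<Rightarrow> real^'m) \<Rightarrow> real^'m \<Rightarrow> (real \<Rightarrow> real^'k) \<Rightarrow> real \<Rightarrow> real^'m" where
  "trajY g y \<beta> = trajectory (\<lambda>s z. g z (\<beta> s)) y"

text \<open>Exit times are extended reals, so that the infimum of the empty set is \<open>\<infinity>\<close>.\<close>

definition exit_time :: "'a::euclidean_space set \<Rightarrow> (real \<Rightarrow> 'a) \<Rightarrow> ereal" where
  "exit_time \<Omega> Z = (INF t\<in>{t. 0 \<le> t \<and> Z t \<notin> closure \<Omega>}. ereal t)"

definition running_cost ::
    "real \<Rightarrow> (real^'n \<Rightarrow> real^'m \<Rightarrow> real^'n \<Rightarrow> real^'k \<Rightarrow> real)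
      \<Rightarrow> (real^'n \<Rightarrow> real^'n) \<Rightarrow> real^'k^'n \<Rightarrow> (real^'m \<Rightarrow> real^'k \<Rightarrow> real^'m)
      \<Rightarrow> real \<Rightarrow> real^'n \<Rightarrow> real^'m \<Rightarrow> (real \<Rightarrow> real^'n) \<Rightarrow> (real \<Rightarrow> real^'k) \<Rightarrow> real" where
  "running_cost lam \<l> f D g \<sigma> x y \<alpha> \<beta> =
     (LINT t:{0..\<sigma>}|lebesgue.
        exp (- lam * t) * \<l> (trajX f D x \<alpha> \<beta> t) (trajY g y \<beta> t) (\<alpha> t) (\<beta> t))"

text \<open>The open half-space through the origin whose outer unit normal, at every boundary point,
  is the unit vector \<open>\<eta>\<close>.\<close>

definition open_halfspace :: "'a::euclidean_space \<Rightarrow> 'a set" where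
  "open_halfspace \<eta> = {x. x \<bullet> \<eta> < 0}"

text \<open>Here \<open>\<eta>\<close> is the outer unit normal of the set at the boundary point under consideration.\<close>

definition strictly_entering :: "'a::euclidean_space \<Rightarrow> 'a \<Rightarrow> bool" where
  "strictly_entering \<eta> v \<longleftrightarrow> v \<bullet> \<eta> < 0"

definition strictly_entering_compl :: "'a::euclidean_space \<Rightarrow> 'a \<Rightarrow> bool" where
  "strictly_entering_compl \<eta> v \<longleftrightarrow> v \<bullet> \<eta> > 0"

definition modulus_of_continuity :: "(real \<Rightarrow> real) \<Rightarrow> bool" where
  "modulus_of_continuity \<omega> \<longleftrightarrow>
     \<omega> \<in> {0..} \<rightarrow> {0..} \<and> mono_on {0..} \<omega> \<and> continuous_on {0..} \<omega> \<and> \<omega> 0 = 0"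

end

theory Submission
  imports Defs
begin

text \<open>Both players face the same problem: a follower, close to a leader, has to stay in the half-space
  as long as the leader does, while copying the leader's control up to a set of small measure. No
  time delay is needed. Near the boundary point \<open>y\<close> let \<open>u\<close> be an entering control, with speed \<open>c\<close>. The
  follower copies the leader's control \<open>v\<close>, except that it plays \<open>u\<close> instead whenever
  \<open>F y v \<bullet> \<eta> > F y u \<bullet> \<eta> + c / 2\<close>, until the replacements have used up a budget of time proportional
  to the initial distance. As long as the budget lasts, everything the follower plays is entering;
  once it is exhausted, the replacements have gained more in the direction \<open>- \<eta>\<close> than the initial
  distance and the drift can cost, so that from then on the follower lies deeper than the leader.
  This works on a time interval of length proportional to \<open>c\<close>, and one iterates. The rule only
  looks at the past, all errors are linear in the initial distance, and the set where the controls
  differ has measure linear in it, which bounds the difference of the costs.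

  For player \<open>Y\<close> the follower is the trajectory from \<open>y2\<close> and the leader that from \<open>y1\<close>. For player
  \<open>X\<close> the follower starts at \<open>x1\<close> and the leader at \<open>x2\<close>; the terms \<open>D *v \<beta>\<close> and \<open>D *v \<beta>'\<close> are
  perturbations whose difference is small in \<open>L\<^sup>1\<close>, and entering uniformly in \<open>b\<close> makes the argument
  insensitive to them.\<close>

section \<open>Lipschitz fields measurable in time\<close>

lemma bounded_measurable_absolutely_integrable:
  fixes \<phi> :: "real \<Rightarrow> 'a::euclidean_space"
  assumes "\<phi> \<in> borel_measurable (lebesgue_on {0..})" and "\<And>s. s \<ge> 0 \<Longrightarrow> norm (\<phi> s) \<le> M"
    and "0 \<le> a"
  shows "\<phi> absolutely_integrable_on {a..b}"
proof -
  have sub: "{a..b} \<subseteq> {0..}" using assms(3) by auto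
  have "\<phi> \<in> borel_measurable (lebesgue_on {a..b})"
    by (rule measurable_restrict_mono[OF assms(1) sub])
  moreover have "(\<lambda>_. M) integrable_on {a..b}" by (rule integrable_const_ivl)
  ultimately show ?thesis
    by (intro measurable_bounded_by_integrable_imp_absolutely_integrable[where g="\<lambda>_. M"])
       (use assms sub in auto)
qed

lemma integral_exp_shift:
  fixes L :: real
  assumes "L > 0" "a \<le> t"
  shows "(\<lambda>s. exp (2 * L * (s - a))) integrable_on {a..t}"
    and "integral {a..t} (\<lambda>s. exp (2 * L * (s - a))) = (exp (2 * L * (t - a)) - 1) / (2 * L)"
proof -
  have "((\<lambda>s. exp (2 * L * (s - a))) has_integral
      exp (2 * L * (t - a)) / (2 * L) - exp (2 * L * (a - a)) / (2 * L)) {a..t}"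
    by (rule fundamental_theorem_of_calculus)
       (use assms in \<open>auto intro!: derivative_eq_intros
          simp flip: has_real_derivative_iff_has_vector_derivative\<close>)
  then show "(\<lambda>s. exp (2 * L * (s - a))) integrable_on {a..t}"
    "integral {a..t} (\<lambda>s. exp (2 * L * (s - a))) = (exp (2 * L * (t - a)) - 1) / (2 * L)"
    by (auto simp: has_integral_iff diff_divide_distrib)
qed

text \<open>The proof evaluates the hypothesis at a maximum point of the weighted function
  \<open>exp (- 2 * L * (s - a)) * d s\<close>. With the maximum \<open>S\<close> inserted, the
  integral term returns at most half of the left-hand side, so \<open>S \<le> 2 * e\<close>. The
  exponent \<open>2 * L\<close> is chosen for this halving.\<close>

lemma gronwall_weighted:
  fixes d :: "real \<Rightarrow> real"
  assumes cont: "continuous_on {a..b} d" and L: "L > 0" and e: "e \<ge> 0"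
    and le: "\<And>t. t \<in> {a..b} \<Longrightarrow> d t \<le> e + L * integral {a..t} d"
    and t: "t \<in> {a..b}"
  shows "d t \<le> 2 * e * exp (2 * L * (t - a))"
proof -
  let ?m = "\<lambda>s. exp (- 2 * L * (s - a)) * d s"
  have "continuous_on {a..b} ?m" using cont by (intro continuous_intros)
  moreover have "compact {a..b}" "{a..b} \<noteq> {}" using t by auto
  ultimately obtain r where r: "r \<in> {a..b}" and max: "\<And>s. s \<in> {a..b} \<Longrightarrow> ?m s \<le> ?m r"
    using continuous_attains_sup[of "{a..b}" ?m] by blast
  define S where "S = ?m r"
  have dm: "d s = ?m s * exp (2 * L * (s - a))" for s
  proof -
    have "exp (- 2 * L * (s - a)) * exp (2 * L * (s - a)) = 1" by (simp flip: exp_add)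
    then show ?thesis by (metis mult.assoc mult.commute mult_1)
  qed
  have dle: "d s \<le> S * exp (2 * L * (s - a))" if "s \<in> {a..b}" for s
    using mult_right_mono[OF max[OF that], of "exp (2 * L * (s - a))"] dm[of s]
    by (simp only: S_def exp_ge_zero)
  have S2e: "S \<le> 2 * e"
  proof (cases "S \<le> 0")
    case False
    have "integral {a..r} d \<le> integral {a..r} (\<lambda>s. S * exp (2 * L * (s - a)))"
    proof (rule integral_le)
      show "d integrable_on {a..r}"
        using r by (intro integrable_continuous_real continuous_on_subset[OF cont]) auto
      show "(\<lambda>s. S * exp (2 * L * (s - a))) integrable_on {a..r}"
        by (intro integrable_continuous_real continuous_intros)
    qed (use dle r in auto)
    also have "\<dots> = S * ((exp (2 * L * (r - a)) - 1) / (2 * L))"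
      using r L by (simp add: integral_exp_shift)
    also have "\<dots> \<le> S * (exp (2 * L * (r - a)) / (2 * L))"
      using False L by (intro mult_left_mono divide_right_mono) auto
    finally have "L * integral {a..r} d \<le> S * exp (2 * L * (r - a)) / 2"
      using L by (simp add: field_simps)
    then have "d r \<le> e + S * exp (2 * L * (r - a)) / 2" using le[OF r] by linarith
    moreover have "d r = S * exp (2 * L * (r - a))"
      unfolding S_def by (rule dm)
    ultimately have "S * exp (2 * L * (r - a)) \<le> 2 * e" by linarith
    moreover have "S * 1 \<le> S * exp (2 * L * (r - a))"
      using False L r by (intro mult_left_mono) auto
    ultimately show ?thesis by linarith
  qed (use e in auto)
  have "d t \<le> S * exp (2 * L * (t - a))" by (rule dle[OF t])
  also have "\<dots> \<le> 2 * e * exp (2 * L * (t - a))" using S2e by (intro mult_right_mono) auto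
  finally show ?thesis .
qed

text \<open>Measurability is only required along continuous curves: this is all the Picard operator needs.\<close>

definition lipschitz_field :: "real \<Rightarrow> real \<Rightarrow> (real \<Rightarrow> 'a::euclidean_space \<Rightarrow> 'a) \<Rightarrow> bool" where
  "lipschitz_field M L G \<longleftrightarrow> L > 0 \<and> M \<ge> 0 \<and>
     (\<forall>z. continuous_on {0..} z \<longrightarrow> (\<lambda>s. G s (z s)) \<in> borel_measurable (lebesgue_on {0..})) \<and>
     (\<forall>s\<ge>0. \<forall>z. norm (G s z) \<le> M) \<and>
     (\<forall>s\<ge>0. \<forall>z z'. norm (G s z - G s z') \<le> L * norm (z - z'))"

lemma lipschitz_fieldD:
  assumes "lipschitz_field M L G"
  shows "L > 0" "M \<ge> 0"
    "\<And>z. continuous_on {0..} z \<Longrightarrow> (\<lambda>s. G s (z s)) \<in> borel_measurable (lebesgue_on {0..})"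
    "\<And>s z. s \<ge> 0 \<Longrightarrow> norm (G s z) \<le> M"
    "\<And>s z z'. s \<ge> 0 \<Longrightarrow> norm (G s z - G s z') \<le> L * norm (z - z')"
  using assms unfolding lipschitz_field_def by auto

lemma lipschitz_field_integrable:
  assumes "lipschitz_field M L G" "continuous_on {0..} z" "0 \<le> a"
  shows "(\<lambda>s. G s (z s)) absolutely_integrable_on {a..b}"
    and "(\<lambda>s. G s (z s)) integrable_on {a..b}"
    and "a \<le> b \<Longrightarrow> norm (integral {a..b} (\<lambda>s. G s (z s))) \<le> M * (b - a)"
proof -
  show *: "(\<lambda>s. G s (z s)) absolutely_integrable_on {a..b}"
    using assms lipschitz_fieldD[OF assms(1)]
    by (intro bounded_measurable_absolutely_integrable[where M=M]) auto
  then show i: "(\<lambda>s. G s (z s)) integrable_on {a..b}"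
    by (simp add: set_lebesgue_integral_eq_integral(1))
  show "norm (integral {a..b} (\<lambda>s. G s (z s))) \<le> M * (b - a)" if "a \<le> b"
  proof -
    have "norm (integral {a..b} (\<lambda>s. G s (z s))) \<le> integral {a..b} (\<lambda>_. M)"
      using assms lipschitz_fieldD[OF assms(1)] by (intro integral_norm_bound_integral i) auto
    then show ?thesis using that by (simp add: mult.commute)
  qed
qed

text \<open>The bound covers negative times too, where the integral runs over an empty interval and
  is 0. The Picard operator needs this, because it acts on bounded continuous functions on the whole
  line.\<close>

lemma lipschitz_field_integral_increment:
  assumes G: "lipschitz_field M L G" and z: "continuous_on {0..} z"
  defines "I \<equiv> \<lambda>t. integral {0..t} (\<lambda>s. G s (z s))"
  shows "norm (I t' - I t) \<le> M * \<bar>t' - t\<bar>"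
proof -
  have main: "norm (I t' - I t) \<le> M * (t' - t)" if "t \<le> t'" for t t'
  proof (cases "0 \<le> t")
    case True
    have "I t + integral {t..t'} (\<lambda>s. G s (z s)) = I t'"
      unfolding I_def using True that
      by (intro Henstock_Kurzweil_Integration.integral_combine
          lipschitz_field_integrable[OF G z]) auto
    then have "I t' - I t = integral {t..t'} (\<lambda>s. G s (z s))" by (metis add_diff_cancel_left')
    then show ?thesis using lipschitz_field_integrable(3)[OF G z True that] by simp
  next
    case False
    then have [simp]: "I t = 0" by (simp add: I_def)
    show ?thesis
    proof (cases "0 \<le> t'")
      case True
      have "norm (I t') \<le> M * t'"
        using lipschitz_field_integrable(3)[OF G z order_refl True] by (simp add: I_def)
      also have "\<dots> \<le> M * (t' - t)"
        using False lipschitz_fieldD(2)[OF G] by (intro mult_left_mono) auto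
      finally show ?thesis by simp
    next
      case neg: False
      then have "I t' = 0" by (simp add: I_def)
      then show ?thesis using lipschitz_fieldD(2)[OF G] that by simp
    qed
  qed
  show ?thesis
  proof (cases "t \<le> t'")
    case True then show ?thesis using main[OF True] by simp
  next
    case False
    then have "norm (I t - I t') \<le> M * (t - t')" using main[of t' t] by simp
    then show ?thesis using False by (simp add: norm_minus_commute)
  qed
qed

lemma lipschitz_curve_continuous_on:
  fixes I :: "real \<Rightarrow> 'a::real_normed_vector"
  assumes "\<And>t t'. t \<in> S \<Longrightarrow> t' \<in> S \<Longrightarrow> norm (I t' - I t) \<le> M * \<bar>t' - t\<bar>" "M \<ge> 0"
  shows "continuous_on S I"
  using assms
  by (intro lipschitz_on_continuous_on[of M] lipschitz_onI)
     (auto simp: dist_norm)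

text \<open>The bound \<open>M\<close> turns the integral equation into a Lipschitz estimate for
  \<open>Z\<close>, hence continuity; conversely, a field measurable along continuous curves and
  bounded is integrable along \<open>Z\<close>. This moves the work from Lebesgue set integrals to
  Henstock-Kurzweil integrals.\<close>

lemma caratheodory_solution_iff:
  assumes G: "lipschitz_field M L G"
  shows "caratheodory_solution G x0 Z \<longleftrightarrow>
    continuous_on {0..} Z \<and> (\<forall>t\<ge>0. Z t = x0 + integral {0..t} (\<lambda>s. G s (Z s)))"
proof
  assume *: "caratheodory_solution G x0 Z"
  then have int: "(\<lambda>s. G s (Z s)) absolutely_integrable_on {0..t}"
    and eq: "Z t = x0 + integral {0..t} (\<lambda>s. G s (Z s))" if "t \<ge> 0" for t
    using that set_lebesgue_integral_eq_integral(2)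
    by (fastforce simp: caratheodory_solution_def)+
  have "continuous_on {0..} Z"
  proof (rule lipschitz_curve_continuous_on)
    have main: "norm (Z t' - Z t) \<le> M * (t' - t)" if "0 \<le> t" "t \<le> t'" for t t'
    proof -
      have i: "(\<lambda>s. G s (Z s)) integrable_on {0..t'}"
        using int[of t'] that by (simp add: set_lebesgue_integral_eq_integral(1))
      then have i2: "(\<lambda>s. G s (Z s)) integrable_on {t..t'}"
        by (rule integrable_on_subinterval) (use that in auto)
      have "integral {0..t} (\<lambda>s. G s (Z s)) + integral {t..t'} (\<lambda>s. G s (Z s))
          = integral {0..t'} (\<lambda>s. G s (Z s))"
        using that by (intro Henstock_Kurzweil_Integration.integral_combine i) auto
      then have "Z t' - Z t = integral {t..t'} (\<lambda>s. G s (Z s))"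
        using that eq[of t] eq[of t'] by (simp add: algebra_simps)
      also have "norm \<dots> \<le> integral {t..t'} (\<lambda>_. M)"
        using i2 that lipschitz_fieldD(4)[OF G] by (intro integral_norm_bound_integral) auto
      finally show ?thesis using that by (simp add: mult.commute)
    qed
    show "norm (Z t' - Z t) \<le> M * \<bar>t' - t\<bar>" if "t \<in> {0..}" "t' \<in> {0..}" for t t'
      using main[of t t'] main[of t' t] that
      by (cases "t \<le> t'") (auto simp: norm_minus_commute)
  qed (use lipschitz_fieldD(2)[OF G] in auto)
  then show "continuous_on {0..} Z \<and> (\<forall>t\<ge>0. Z t = x0 + integral {0..t} (\<lambda>s. G s (Z s)))"
    using eq by blast
next
  assume "continuous_on {0..} Z \<and> (\<forall>t\<ge>0. Z t = x0 + integral {0..t} (\<lambda>s. G s (Z s)))"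
  then show "caratheodory_solution G x0 Z"
    unfolding caratheodory_solution_def
    using lipschitz_field_integrable(1)[OF G, of Z 0]
    by (auto simp: set_lebesgue_integral_eq_integral(2))
qed

text \<open>Picard iteration for the unknown \<open>u t = exp (- 2 L t) (Z t - x0)\<close>: with this weight the
  integral operator is a contraction on the whole half-line at once.\<close>

lemma caratheodory_solution_exists:
  assumes G: "lipschitz_field M L G"
  shows "\<exists>Z. caratheodory_solution G x0 Z"
proof -
  note GD = lipschitz_fieldD[OF G]
  define z where "z u s = x0 + exp (2 * L * s) *\<^sub>R apply_bcontfun u s"
    for u :: "real \<Rightarrow>\<^sub>C 'a" and s
  define I where "I u t = integral {0..t} (\<lambda>s. G s (z u s))" for u t
  define T where "T u = Bcontfun (\<lambda>t. exp (- 2 * L * t) *\<^sub>R I u t)" for u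
  have zc: "continuous_on S (z u)" for u S
    unfolding z_def by (intro continuous_intros) auto
  have Ic: "continuous_on S (I u)" for u S
    using lipschitz_field_integral_increment[OF G zc] GD(2) unfolding I_def
    by (intro lipschitz_curve_continuous_on) auto
  \<comment> \<open>The integral grows at most like \<open>M * t\<close>, and
    \<open>2 * L * t \<le> exp (2 * L * t)\<close>, so the weight makes the image bounded.\<close>
  have mem: "(\<lambda>t. exp (- 2 * L * t) *\<^sub>R I u t) \<in> bcontfun" for u
  proof (rule bcontfun_normI)
    show "continuous_on UNIV (\<lambda>t. exp (- 2 * L * t) *\<^sub>R I u t)"
      by (intro continuous_intros Ic)
    show "norm (exp (- 2 * L * t) *\<^sub>R I u t) \<le> M / (2 * L)" for t
    proof (cases "t \<ge> 0")
      case True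
      have "norm (I u t) \<le> M * t"
        using lipschitz_field_integrable(3)[OF G zc order_refl True] by (simp add: I_def)
      also have "\<dots> \<le> M * (exp (2 * L * t) / (2 * L))"
      proof (intro mult_left_mono GD(2))
        have "2 * L * t \<le> exp (2 * L * t)" using exp_ge_add_one_self[of "2 * L * t"] by linarith
        then show "t \<le> exp (2 * L * t) / (2 * L)" using GD(1) by (simp add: field_simps)
      qed
      finally have "exp (- 2 * L * t) * norm (I u t)
          \<le> exp (- 2 * L * t) * (M * (exp (2 * L * t) / (2 * L)))"
        by (intro mult_left_mono) auto
      also have "\<dots> = exp (- 2 * L * t) * exp (2 * L * t) * (M / (2 * L))" by simp
      also have "\<dots> = M / (2 * L)" by (simp flip: exp_add)
      finally show ?thesis by simp
    next
      case False
      then show ?thesis using GD by (simp add: I_def)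
    qed
  qed
  have T_apply: "apply_bcontfun (T u) t = exp (- 2 * L * t) *\<^sub>R I u t" for u t
    unfolding T_def by (subst Bcontfun_inverse[OF mem]) (rule refl)
  have "\<exists>!u. T u = u"
  \<comment> \<open>\<open>L\<close> times the integral of \<open>exp (2 * L * s)\<close> over
    \<open>{0..t}\<close> is at most half of \<open>exp (2 * L * t)\<close>, and the outer weight
    cancels this exponential: hence the factor 1/2. At negative times both images are 0.\<close>
  proof (rule banach_fix_type[of "1/2"])
    show "\<forall>u v. dist (T u) (T v) \<le> 1/2 * dist u v"
    proof (intro allI, rule dist_bound)
      fix u v t
      show "dist (apply_bcontfun (T u) t) (apply_bcontfun (T v) t) \<le> 1/2 * dist u v"
      proof (cases "t \<ge> 0")
        case True
        have iG: "(\<lambda>s. G s (z w s)) integrable_on {0..t}" for w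
          by (rule lipschitz_field_integrable(2)[OF G zc]) simp
        have "norm (I u t - I v t) = norm (integral {0..t} (\<lambda>s. G s (z u s) - G s (z v s)))"
          unfolding I_def by (simp add: Henstock_Kurzweil_Integration.integral_diff[OF iG iG])
        also have "\<dots> \<le> integral {0..t} (\<lambda>s. L * dist u v * exp (2 * L * (s - 0)))"
        proof (rule integral_norm_bound_integral)
          show "(\<lambda>s. G s (z u s) - G s (z v s)) integrable_on {0..t}"
            by (intro integrable_diff iG)
          show "(\<lambda>s. L * dist u v * exp (2 * L * (s - 0))) integrable_on {0..t}"
            by (intro integrable_continuous_real continuous_intros)
          fix s assume "s \<in> {0..t}"
          then have "norm (G s (z u s) - G s (z v s)) \<le> L * norm (z u s - z v s)"
            by (intro GD(5)) auto
          also have "z u s - z v s = exp (2 * L * s) *\<^sub>R (apply_bcontfun u s - apply_bcontfun v s)"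
            by (simp add: z_def algebra_simps)
          also have "norm \<dots> = exp (2 * L * s) * dist (apply_bcontfun u s) (apply_bcontfun v s)"
            by (simp add: dist_norm)
          also have "L * \<dots> \<le> L * (exp (2 * L * s) * dist u v)"
            using GD(1) by (intro mult_left_mono dist_bounded) auto
          finally show "norm (G s (z u s) - G s (z v s)) \<le> L * dist u v * exp (2 * L * (s - 0))"
            by (simp add: mult_ac)
        qed
        also have "\<dots> = L * dist u v * ((exp (2 * L * t) - 1) / (2 * L))"
          using integral_exp_shift[OF GD(1) True] by simp
        also have "\<dots> = dist u v * (exp (2 * L * t) - 1) / 2" using GD(1) by (simp add: field_simps)
        also have "\<dots> \<le> dist u v * exp (2 * L * t) / 2"
          by (intro divide_right_mono mult_left_mono) auto
        finally have "exp (- 2 * L * t) * norm (I u t - I v t)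
           \<le> exp (- 2 * L * t) * (dist u v * exp (2 * L * t) / 2)"
          by (intro mult_left_mono) auto
        also have "\<dots> = exp (- 2 * L * t) * exp (2 * L * t) * (dist u v / 2)" by simp
        also have "\<dots> = dist u v / 2" by (simp flip: exp_add)
        finally show ?thesis
          by (simp add: T_apply dist_norm flip: scaleR_diff_right)
      next
        case False
        then show ?thesis by (simp add: T_apply I_def)
      qed
    qed
  qed auto
  then obtain u where u: "T u = u" by blast
  have "z u t = x0 + integral {0..t} (\<lambda>s. G s (z u s))" for t
  proof -
    have "apply_bcontfun u t = exp (- 2 * L * t) *\<^sub>R I u t" using T_apply[of u t] u by simp
    then have "z u t = x0 + (exp (2 * L * t) * exp (- 2 * L * t)) *\<^sub>R I u t"
      by (simp add: z_def)
    then show ?thesis by (simp add: I_def flip: exp_add)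
  qed
  then show ?thesis using caratheodory_solution_iff[OF G] zc by blast
qed

section \<open>Trajectories: integral equation, speed bound, dependence on the field\<close>

lemma trajectory_solution:
  assumes G: "lipschitz_field M L G"
  shows "continuous_on {0..} (trajectory G x0)"
    and "t \<ge> 0 \<Longrightarrow> trajectory G x0 t = x0 + integral {0..t} (\<lambda>s. G s (trajectory G x0 s))"
  using someI_ex[OF caratheodory_solution_exists[OF G, of x0]] caratheodory_solution_iff[OF G]
  unfolding trajectory_def by blast+

lemma trajectory_0: "lipschitz_field M L G \<Longrightarrow> trajectory G x0 0 = x0"
  using trajectory_solution(2)[of M L G 0 x0] by simp

lemma trajectory_restart:
  assumes G: "lipschitz_field M L G" and "0 \<le> a" "a \<le> t"
  shows "trajectory G x0 t = trajectory G x0 a + integral {a..t} (\<lambda>s. G s (trajectory G x0 s))"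
proof -
  let ?Z = "trajectory G x0"
  have "integral {0..a} (\<lambda>s. G s (?Z s)) + integral {a..t} (\<lambda>s. G s (?Z s))
      = integral {0..t} (\<lambda>s. G s (?Z s))"
    using assms lipschitz_field_integrable(2)[OF G trajectory_solution(1)[OF G]]
    by (intro Henstock_Kurzweil_Integration.integral_combine) auto
  then show ?thesis
    using trajectory_solution(2)[OF G, of a x0] trajectory_solution(2)[OF G, of t x0] assms
    by (simp add: algebra_simps)
qed

lemma trajectory_increment:
  assumes G: "lipschitz_field M L G" and "0 \<le> a" "a \<le> t"
  shows "norm (trajectory G x0 t - trajectory G x0 a) \<le> M * (t - a)"
  using trajectory_restart[OF assms, of x0]
    lipschitz_field_integrable(3)[OF G trajectory_solution(1)[OF G] assms(2,3)]
  by (metis add_diff_cancel_left')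

text \<open>The two integral equations differ only on a null set of times common to all states, so
  Gronwall applies with zero initial error. Causality rests on this: controls that agree almost
  everywhere in the past lead to exactly the same position.\<close>

lemma trajectory_cong_AE:
  assumes G: "lipschitz_field M L G" and H: "lipschitz_field M' L' H"
    and ae: "AE s in lebesgue_on {0..t}. \<forall>z. G s z = H s z" and s: "s \<in> {0..t}"
  shows "trajectory G x0 s = trajectory H x0 s"
proof -
  let ?Z = "trajectory G x0" and ?W = "trajectory H x0"
  note Z = trajectory_solution[OF G] and W = trajectory_solution[OF H]
  let ?d = "\<lambda>s. norm (?Z s - ?W s)"
  have dc: "continuous_on {0..b} ?d" for b
    by (intro continuous_intros continuous_on_subset[OF Z(1)] continuous_on_subset[OF W(1)]) auto
  obtain N where N: "negligible N" "\<And>s z. s \<in> {0..t} - N \<Longrightarrow> G s z = H s z"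
  proof -
    have "AE s in lebesgue. s \<in> {0..t} \<longrightarrow> (\<forall>z. G s z = H s z)"
      using ae by (subst (asm) AE_restrict_space_iff) auto
    then obtain N where "N \<in> null_sets lebesgue"
        "{s. \<not> (s \<in> {0..t} \<longrightarrow> (\<forall>z. G s z = H s z))} \<subseteq> N"
      unfolding eventually_ae_filter by auto
    then show ?thesis by (intro that[of N]) (auto simp: negligible_iff_null_sets)
  qed
  have "?d s \<le> 2 * 0 * exp (2 * L * (s - 0))"
  proof (rule gronwall_weighted[OF dc[of t] lipschitz_fieldD(1)[OF G] order_refl _ s])
    fix r assume r: "r \<in> {0..t}"
    have iG: "(\<lambda>s. G s (w s)) integrable_on {0..r}" if "continuous_on {0..} w" for w
      using lipschitz_field_integrable(2)[OF G that] by simp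
    have "integral {0..r} (\<lambda>s. H s (?W s)) = integral {0..r} (\<lambda>s. G s (?W s))"
      using r by (intro integral_spike[OF N(1)]) (auto simp: N(2))
    then have "?Z r - ?W r = integral {0..r} (\<lambda>s. G s (?Z s) - G s (?W s))"
      using r Z(2)[of r x0] W(2)[of r x0]
      by (simp add: Henstock_Kurzweil_Integration.integral_diff[OF iG iG] Z(1) W(1))
    also have "norm \<dots> \<le> integral {0..r} (\<lambda>s. L * ?d s)"
    proof (rule integral_norm_bound_integral)
      show "(\<lambda>s. G s (?Z s) - G s (?W s)) integrable_on {0..r}"
        by (intro integrable_diff iG Z(1) W(1))
      show "(\<lambda>s. L * ?d s) integrable_on {0..r}"
        by (intro integrable_continuous_real continuous_on_mult_left dc)
    qed (use lipschitz_fieldD(5)[OF G] in auto)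
    finally show "?d r \<le> 0 + L * integral {0..r} ?d" by simp
  qed
  then show ?thesis by simp
qed

section \<open>Leader and follower on a short time interval\<close>

lemma lmeasurable_Int_ivl: "N \<in> sets lebesgue \<Longrightarrow> N \<inter> {a..b::real} \<in> lmeasurable"
  by (metis Int_commute fmeasurable_Int_fmeasurable lmeasurable_interval(1))

text \<open>The accumulated measure \<open>\<phi>\<close> starts at 0, is nondecreasing and
  continuous, so the times within the budget form an initial interval \<open>{a..\<theta>}\<close>.
  The budget test on measures thereby becomes a comparison with a single time, which gives both
  measurability of the switching set and the amount used.\<close>

lemma exhaustion_time:
  fixes N :: "real set"
  assumes N: "N \<in> sets lebesgue" and at: "a \<le> t" and bud: "0 \<le> bud"
  defines "\<phi> \<equiv> \<lambda>s. measure lebesgue (N \<inter> {a..s})"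
  obtains \<theta> where "\<theta> \<in> {a..t}" "\<And>s. s \<in> {a..t} \<Longrightarrow> \<phi> s \<le> bud \<longleftrightarrow> s \<le> \<theta>"
    "\<phi> \<theta> \<le> bud" "bud < \<phi> t \<Longrightarrow> \<phi> \<theta> = bud"
proof -
  have meas: "N \<inter> {a..s} \<in> lmeasurable" for s
    by (rule lmeasurable_Int_ivl[OF N])
  have mono: "\<phi> s \<le> \<phi> s'" if "s \<le> s'" for s s'
    unfolding \<phi>_def
    using that by (intro measure_mono_fmeasurable[OF _ fmeasurableD[OF meas] meas]) auto
  have "\<phi> s = integral {a..s} (indicat_real N)" for s
    unfolding \<phi>_def using integral_indicator[OF meas[of s]] by simp
  moreover have "(indicat_real N) integrable_on {a..t}"
    using meas[of t] by (simp add: integrable_on_indicator)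
  ultimately have cont: "continuous_on {a..t} \<phi>"
    using indefinite_integral_continuous_1[of "indicat_real N" a t] by simp
  have \<phi>a: "\<phi> a = 0"
  proof -
    have "\<phi> a \<le> measure lebesgue {a..a}"
      unfolding \<phi>_def
      by (rule measure_mono_fmeasurable[OF Int_lower2 fmeasurableD[OF meas] lmeasurable_interval(1)])
    then show ?thesis by (simp add: \<phi>_def measure_le_0_iff)
  qed
  show ?thesis
  proof (cases "\<phi> t \<le> bud")
    case True
    show ?thesis
    proof (rule that[of t])
      show "\<phi> s \<le> bud \<longleftrightarrow> s \<le> t" if "s \<in> {a..t}" for s
        using that mono[of s t] True by auto
    qed (use True at in auto)
  next
    case False
    have "closed ({s \<in> {a..t}. \<phi> s \<le> bud})"
      using continuous_on_closed_Collect_le[OF cont continuous_on_const, of bud] by simp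
    then have "compact {s \<in> {a..t}. \<phi> s \<le> bud}"
      by (intro compact_eq_bounded_closed[THEN iffD2] conjI bounded_subset[OF bounded_closed_interval[of a t]]) auto
    moreover have "a \<in> {s \<in> {a..t}. \<phi> s \<le> bud}" using at \<phi>a bud by auto
    ultimately obtain \<theta> where \<theta>: "\<theta> \<in> {a..t}" "\<phi> \<theta> \<le> bud"
        and max: "\<And>s. s \<in> {a..t} \<Longrightarrow> \<phi> s \<le> bud \<Longrightarrow> s \<le> \<theta>"
      using compact_attains_sup[of "{s \<in> {a..t}. \<phi> s \<le> bud}"] by auto
    \<comment> \<open>The last time within the budget lies at or after a time \<open>r\<close> where
      the budget is met exactly, so by monotonicity it is met exactly at \<open>\<theta>\<close>
      too.\<close>
    obtain r where r: "r \<in> {a..t}" "\<phi> r = bud"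
      using IVT'[of \<phi> a bud t, OF _ _ at cont] False \<phi>a bud by auto
    show ?thesis
    proof (rule that[OF \<theta>(1)])
      show "\<phi> s \<le> bud \<longleftrightarrow> s \<le> \<theta>" if "s \<in> {a..t}" for s
        using max[OF that] mono[of s \<theta>] \<theta>(2) by auto
      show "\<phi> \<theta> = bud" using max[of r] r mono[of r \<theta>] \<theta>(2) by auto
    qed (rule \<theta>)
  qed
qed

lemma AE_lebesgue_on_ivl_iff:
  "(AE s in lebesgue_on {a..b::real}. Q s) \<longleftrightarrow> (AE s in lebesgue. s \<in> {a..b} \<longrightarrow> Q s)"
  by (rule AE_restrict_space_iff) simp

lemma AE_lebesgue_on_ivl_mono:
  assumes "AE s in lebesgue_on {a..b::real}. Q s" "b' \<le> b"
  shows "AE s in lebesgue_on {a..b'}. Q s"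
  using assms(1) unfolding AE_lebesgue_on_ivl_iff
  by (rule eventually_mono) (use assms(2) in auto)

text \<open>The right endpoint is negligible. Rules from different stages agree only strictly before
  the stage boundary, and this form covers that case.\<close>

lemma AE_lebesgue_on_ivlI:
  assumes "\<And>s::real. a \<le> s \<Longrightarrow> s < b \<Longrightarrow> Q s"
  shows "AE s in lebesgue_on {a..b}. Q s"
  unfolding AE_lebesgue_on_ivl_iff
proof (rule AE_I'[of "{b}"])
  show "{b} \<in> null_sets lebesgue" by (simp flip: negligible_iff_null_sets)
  show "{s \<in> space lebesgue. \<not> (s \<in> {a..b} \<longrightarrow> Q s)} \<subseteq> {b}" using assms by force
qed

lemma controls_neq_sets:
  fixes v v' :: "real \<Rightarrow> 'a::euclidean_space"
  assumes "v \<in> borel_measurable (lebesgue_on {0..})" "v' \<in> borel_measurable (lebesgue_on {0..})" "0 \<le> a"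
  shows "{s \<in> {a..b}. v s \<noteq> v' s} \<in> lmeasurable"
proof -
  have "{s \<in> space (lebesgue_on {0..}). v s \<noteq> v' s} \<in> sets (lebesgue_on {0..})"
    using assms by measurable
  then have "{s. s \<ge> 0 \<and> v s \<noteq> v' s} \<in> sets lebesgue"
    by (subst (asm) sets_restrict_space_iff) auto
  then have "{s. s \<ge> 0 \<and> v s \<noteq> v' s} \<inter> {a..b} \<in> lmeasurable"
    by (rule lmeasurable_Int_ivl)
  moreover have "{s. s \<ge> 0 \<and> v s \<noteq> v' s} \<inter> {a..b} = {s \<in> {a..b}. v s \<noteq> v' s}" using assms(3) by auto
  ultimately show ?thesis by simp
qed

lemma controlsD:
  assumes "v \<in> controls U"
  shows "s \<ge> 0 \<Longrightarrow> v s \<in> U" and "v \<in> borel_measurable (lebesgue_on {0..})"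
  using assms by (auto simp: controls_def PiE_def)

text \<open>\<open>G\<close> is continuous only over \<open>UNIV \<times> U\<close>, so the curve of
  pairs is first regarded as a measurable map into that subspace.\<close>

lemma borel_measurable_along_curve:
  fixes z :: "real \<Rightarrow> 'a::euclidean_space" and G :: "'a \<times> 'b::euclidean_space \<Rightarrow> 'c::euclidean_space"
  assumes G: "continuous_on (UNIV \<times> U) G" and z: "continuous_on {0..} z" and v: "v \<in> controls U"
  shows "(\<lambda>s. G (z s, v s)) \<in> borel_measurable (lebesgue_on {0..})"
proof -
  have "z \<in> borel_measurable (lebesgue_on {0..})"
    by (rule continuous_imp_measurable_on_sets_lebesgue[OF z]) simp
  then have "(\<lambda>s. (z s, v s)) \<in> borel_measurable (lebesgue_on {0..})"
    using controlsD(2)[OF v] by (rule borel_measurable_Pair)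
  then have "(\<lambda>s. (z s, v s)) \<in> measurable (lebesgue_on {0..}) (restrict_space borel (UNIV \<times> U))"
    using controlsD(1)[OF v] by (intro measurable_restrict_space2) auto
  from measurable_compose[OF this borel_measurable_continuous_on_restrict[OF G]]
  show ?thesis .
qed

text \<open>The common abstraction of the two players. Player \<open>Y\<close> has
  \<open>F = g\<close> and \<open>P = {0}\<close>; player \<open>X\<close> has
  \<open>F z a = f z + a\<close>, with \<open>P\<close> the image of \<open>B\<close> under
  \<open>D\<close>, so that the other player's influence is a perturbation. In
  \<open>entering\<close> the speed \<open>c\<close> is uniform over \<open>P\<close>, so the
  control can be chosen before the perturbation is known. \<open>M1\<close> and \<open>L1\<close>
  are normalisations that simplify the constants of a stage.\<close>

locale entering_system =
  fixes F :: "'a::euclidean_space \<Rightarrow> 'b::euclidean_space \<Rightarrow> 'a" and U :: "'b set" and P :: "'a set"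
    and \<eta> :: 'a and M L :: real
  assumes compact_U: "compact U"
    and F_cont: "continuous_on (UNIV \<times> U) (\<lambda>(z, u). F z u)"
    and F_bound: "u \<in> U \<Longrightarrow> norm (F z u) \<le> M"
    and P_bound: "p \<in> P \<Longrightarrow> norm p \<le> M"
    and F_P_bound: "u \<in> U \<Longrightarrow> p \<in> P \<Longrightarrow> norm (F z u + p) \<le> M"
    and F_lip: "u \<in> U \<Longrightarrow> norm (F z u - F z' u) \<le> L * norm (z - z')"
    and M1: "1 \<le> M" and L1: "1 \<le> L"
    and norm_eta: "norm \<eta> = 1"
    and entering: "y \<bullet> \<eta> = 0 \<Longrightarrow> \<exists>u\<in>U. \<exists>c>0. \<forall>p\<in>P. (F y u + p) \<bullet> \<eta> \<le> - c"
begin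

text \<open>No extensionality as in \<open>controls\<close>: at negative \<open>s\<close> the value
  \<open>D *v \<beta> s\<close> need not be \<open>undefined\<close>.\<close>

definition perturbations :: "(real \<Rightarrow> 'a) set" where
  "perturbations = {p \<in> borel_measurable (lebesgue_on {0..}). \<forall>s\<ge>0. p s \<in> P}"

definition vfield :: "(real \<Rightarrow> 'b) \<Rightarrow> (real \<Rightarrow> 'a) \<Rightarrow> real \<Rightarrow> 'a \<Rightarrow> 'a" where
  "vfield v p = (\<lambda>s z. F z (v s) + p s)"

lemma inner_eta_le: "x \<bullet> \<eta> \<le> norm x"
  using norm_cauchy_schwarz[of x \<eta>] norm_eta by simp

lemma F_inner_lip: "u \<in> U \<Longrightarrow> F z u \<bullet> \<eta> \<le> F z' u \<bullet> \<eta> + L * norm (z - z')"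
  using inner_eta_le[of "F z u - F z' u"] F_lip[of u z z'] by (simp add: inner_diff_left)

lemma perturbationsD: "p \<in> perturbations \<Longrightarrow> s \<ge> 0 \<Longrightarrow> p s \<in> P"
  "p \<in> perturbations \<Longrightarrow> p \<in> borel_measurable (lebesgue_on {0..})"
  by (auto simp: perturbations_def)

lemma F_measurable:
  assumes z: "continuous_on {0..} z" and v: "v \<in> controls U"
  shows "(\<lambda>s. F (z s) (v s)) \<in> borel_measurable (lebesgue_on {0..})"
  using borel_measurable_along_curve[OF F_cont z v] by simp

lemma lipschitz_field_vfield:
  assumes v: "v \<in> controls U" and p: "p \<in> perturbations"
  shows "lipschitz_field M L (vfield v p)"
  unfolding lipschitz_field_def vfield_def
  using M1 L1 F_P_bound[OF controlsD(1)[OF v] perturbationsD(1)[OF p]] F_lip[OF controlsD(1)[OF v]]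
    F_measurable[OF _ v] perturbationsD(2)[OF p]
  by (auto intro: borel_measurable_add)

lemma perturbations_diff_integrable:
  assumes p: "p \<in> perturbations" "q \<in> perturbations" and a: "0 \<le> a"
  shows "(\<lambda>s. norm (p s - q s)) integrable_on {a..b}"
proof -
  have "(\<lambda>s. norm (p s - q s)) absolutely_integrable_on {a..b}"
  proof (rule bounded_measurable_absolutely_integrable[OF _ _ a])
    show "(\<lambda>s. norm (p s - q s)) \<in> borel_measurable (lebesgue_on {0..})"
      using perturbationsD(2)[OF p(1)] perturbationsD(2)[OF p(2)] by measurable
    fix s :: real assume "0 \<le> s"
    then have "norm (p s) \<le> M" "norm (q s) \<le> M" using perturbationsD(1) p P_bound by auto
    then show "norm (norm (p s - q s)) \<le> M + M"
      using norm_triangle_ineq4[of "p s" "q s"] by simp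
  qed
  then show ?thesis by (rule set_lebesgue_integral_eq_integral(1))
qed

section \<open>Entering speeds uniform on bounded parts of the boundary\<close>

text \<open>A control that enters at \<open>y\<close> with speed \<open>c y\<close> keeps half of
  this speed within distance \<open>c y / (2 * L)\<close>, by the Lipschitz bound. Finitely many
  such balls cover the bounded part of the hyperplane.\<close>

lemma uniformly_entering:
  "\<exists>c. 0 < c \<and> c \<le> 1 \<and> (\<forall>y. y \<bullet> \<eta> = 0 \<longrightarrow> norm y \<le> R \<longrightarrow> (\<exists>u\<in>U. \<forall>p\<in>P. (F y u + p) \<bullet> \<eta> \<le> - c))"
proof -
  let ?K = "{y. y \<bullet> \<eta> = 0} \<inter> cball 0 R"
  have "closed {y. y \<bullet> \<eta> = 0}" using closed_hyperplane[of \<eta> 0] by (simp add: inner_commute)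
  then have "compact ?K" by (simp add: closed_Int_compact)
  have "\<forall>y\<in>{y. y \<bullet> \<eta> = 0}. \<exists>c>0. \<exists>u\<in>U. \<forall>p\<in>P. (F y u + p) \<bullet> \<eta> \<le> - c"
    using entering by fastforce
  from bchoice[OF this] obtain c where c: "\<And>y. y \<bullet> \<eta> = 0 \<Longrightarrow> c y > 0"
      "\<And>y. y \<bullet> \<eta> = 0 \<Longrightarrow> \<exists>u\<in>U. \<forall>p\<in>P. (F y u + p) \<bullet> \<eta> \<le> - c y"
    by auto
  have "\<And>y. y \<in> ?K \<Longrightarrow> open (ball y (c y / (2 * L)))" by simp
  moreover have "?K \<subseteq> (\<Union>y\<in>?K. ball y (c y / (2 * L)))"
    using c(1) L1 by fastforce
  ultimately obtain Y where Y: "Y \<subseteq> ?K" "finite Y" "?K \<subseteq> (\<Union>y\<in>Y. ball y (c y / (2 * L)))"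
    using compactE_image[OF \<open>compact ?K\<close>, of ?K "\<lambda>y. ball y (c y / (2 * L))"] by blast
  \<comment> \<open>The inserted 1 gives the cap \<open>c0 \<le> 1\<close> and keeps the minimum
    meaningful when \<open>Y\<close> is empty.\<close>
  define c0 where "c0 = Min (insert 1 ((\<lambda>y. c y / 2) ` Y))"
  have "0 < c0" unfolding c0_def using Y c(1) by (subst Min_gr_iff) auto
  moreover have "c0 \<le> 1" unfolding c0_def using Y by (intro Min_le) auto
  moreover have "\<exists>u\<in>U. \<forall>p\<in>P. (F y u + p) \<bullet> \<eta> \<le> - c0" if y: "y \<bullet> \<eta> = 0" "norm y \<le> R" for y
  proof -
    obtain y' where y': "y' \<in> Y" "dist y' y < c y' / (2 * L)" using Y(3) y by fastforce
    then have "y' \<bullet> \<eta> = 0" using Y(1) by auto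
    then obtain u where u: "u \<in> U" "\<And>p. p \<in> P \<Longrightarrow> (F y' u + p) \<bullet> \<eta> \<le> - c y'" using c(2) by metis
    have "L * norm (y - y') \<le> c y' / 2"
      using y'(2) L1 by (simp add: dist_norm norm_minus_commute field_simps)
    moreover have "c0 \<le> c y' / 2" unfolding c0_def using Y y'(1) by (intro Min_le) auto
    ultimately have "(F y u + p) \<bullet> \<eta> \<le> - c0" if "p \<in> P" for p
      using u(2)[OF that] F_inner_lip[OF u(1), of y y'] by (simp add: inner_add_left)
    then show ?thesis using u(1) by blast
  qed
  ultimately show ?thesis by blast
qed

text \<open>Taking minima over all integer radii up to the given one makes the rate monotone in the
  radius. Monotonicity is what later prevents the stage lengths from shrinking to 0 in finite
  time.\<close>

lemma entering_rate:
  obtains c :: "real \<Rightarrow> real"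
  where "antimono c" "\<And>r. 0 < c r" "\<And>r. c r \<le> 1"
    "\<And>r y. y \<bullet> \<eta> = 0 \<Longrightarrow> norm y \<le> r \<Longrightarrow> \<exists>u\<in>U. \<forall>p\<in>P. (F y u + p) \<bullet> \<eta> \<le> - c r"
proof -
  have "\<forall>n::nat. \<exists>c. 0 < c \<and> c \<le> 1 \<and>
      (\<forall>y. y \<bullet> \<eta> = 0 \<longrightarrow> norm y \<le> n \<longrightarrow> (\<exists>u\<in>U. \<forall>p\<in>P. (F y u + p) \<bullet> \<eta> \<le> - c))"
    using uniformly_entering by blast
  then obtain c where c: "\<And>n::nat. 0 < c n" "\<And>n. c n \<le> 1"
     "\<And>n y. y \<bullet> \<eta> = 0 \<Longrightarrow> norm y \<le> n \<Longrightarrow> \<exists>u\<in>U. \<forall>p\<in>P. (F y u + p) \<bullet> \<eta> \<le> - c n"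
    by metis
  define m where "m r = Min (c ` {..nat \<lceil>r\<rceil>})" for r :: real
  have m_le: "m r \<le> c (nat \<lceil>r\<rceil>)" for r unfolding m_def by (intro Min_le) auto
  show ?thesis
  proof (rule that[of m])
    show "antimono m"
      unfolding m_def by (intro antimonoI Min_antimono image_mono)
         (auto simp only: atMost_subset_iff intro!: nat_mono ceiling_mono)
    show "0 < m r" for r unfolding m_def using c(1) by (subst Min_gr_iff) auto
    show "m r \<le> 1" for r using m_le[of r] c(2)[of "nat \<lceil>r\<rceil>"] by linarith
    show "\<exists>u\<in>U. \<forall>p\<in>P. (F y u + p) \<bullet> \<eta> \<le> - m r"
      if y: "y \<bullet> \<eta> = 0" "norm y \<le> r" for r y
    proof -
      have "norm y \<le> nat \<lceil>r\<rceil>" using y(2) by linarith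
      then obtain u where "u \<in> U" "\<And>p. p \<in> P \<Longrightarrow> (F y u + p) \<bullet> \<eta> \<le> - c (nat \<lceil>r\<rceil>)"
        using c(3)[OF y(1)] by blast
      then show ?thesis using m_le[of r] by (intro bexI[of _ u]) force+
    qed
  qed
qed

text \<open>Over a stage of length \<open>h \<le> 1 / (2 L)\<close> the Gronwall factor \<open>2 exp (2 L h)\<close> is at most \<open>6\<close>.\<close>

lemma stage_distance:
  fixes z0 w0 :: 'a
  assumes v: "v \<in> controls U" "v' \<in> controls U" and p: "p \<in> perturbations" "q \<in> perturbations"
  defines "Z \<equiv> trajectory (vfield v' p) z0" and "W \<equiv> trajectory (vfield v q) w0"
  assumes a: "0 \<le> a" and h: "0 \<le> h" "L * h \<le> 1 / 2"
    and d: "norm (Z a - W a) \<le> d"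
    and \<kappa>: "integral {a..a+h} (\<lambda>s. norm (p s - q s)) \<le> \<kappa>"
    and m: "measure lebesgue {s \<in> {a..a+h}. v' s \<noteq> v s} \<le> m"
    and t: "t \<in> {a..a+h}"
  shows "norm (Z t - W t) \<le> 6 * (d + \<kappa> + 2 * M * m)"
proof -
  note G = lipschitz_field_vfield[OF v(2) p(1)] and H = lipschitz_field_vfield[OF v(1) p(2)]
  have Zc: "continuous_on {0..} Z" and Wc: "continuous_on {0..} W"
    unfolding Z_def W_def using trajectory_solution(1) G H by auto
  define S where "S = {s \<in> {a..a+h}. v' s \<noteq> v s}"
  have S: "S \<in> lmeasurable"
    unfolding S_def by (rule controls_neq_sets[OF controlsD(2)[OF v(2)] controlsD(2)[OF v(1)] a])
  note pq_int = perturbations_diff_integrable[OF p a]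
  have dc: "continuous_on {a..b} (\<lambda>s. norm (Z s - W s))" for b
    using a by (intro continuous_intros continuous_on_subset[OF Zc] continuous_on_subset[OF Wc]) auto
  have d0: "0 \<le> d" using d norm_ge_zero[of "Z a - W a"] by linarith
  have \<kappa>0: "0 \<le> \<kappa>" using \<kappa> integral_nonneg[OF pq_int[of "a+h"]] by auto
  have m0: "0 \<le> m" by (rule order_trans[OF measure_nonneg m])
  have e0: "0 \<le> d + \<kappa> + 2 * M * m" using d0 \<kappa>0 m0 M1 by simp
  have "norm (Z t - W t) \<le> 2 * (d + \<kappa> + 2 * M * m) * exp (2 * L * (t - a))"
  proof (rule gronwall_weighted[OF dc _ e0 _ t])
    show "L > 0" using L1 by simp
    fix r assume r: "r \<in> {a..a+h}"
    then have ar: "a \<le> r" by simp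
    have iG: "(\<lambda>s. vfield v' p s (Z s)) integrable_on {a..r}"
     and iH: "(\<lambda>s. vfield v q s (W s)) integrable_on {a..r}"
      using lipschitz_field_integrable(2) G H Zc Wc a by blast+
    have iS: "indicat_real S integrable_on {a..r}"
      using S by (metis integrable_on_indicator fmeasurable_Int_fmeasurable fmeasurableD lmeasurable_interval(1))
    have "Z r - W r = (Z a - W a) + integral {a..r} (\<lambda>s. vfield v' p s (Z s) - vfield v q s (W s))"
      using trajectory_restart[OF G a ar, of z0] trajectory_restart[OF H a ar, of w0]
      unfolding Z_def[symmetric] W_def[symmetric]
      by (simp add: Henstock_Kurzweil_Integration.integral_diff[OF iG iH])
    then have "norm (Z r - W r) \<le> d
        + norm (integral {a..r} (\<lambda>s. vfield v' p s (Z s) - vfield v q s (W s)))"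
      by (simp only:) (rule norm_triangle_mono[OF d order_refl])
    also have "norm (integral {a..r} (\<lambda>s. vfield v' p s (Z s) - vfield v q s (W s)))
       \<le> integral {a..r} (\<lambda>s. (L * norm (Z s - W s) + norm (p s - q s)) + 2 * M * indicat_real S s)"
    proof (rule integral_norm_bound_integral)
      show "(\<lambda>s. vfield v' p s (Z s) - vfield v q s (W s)) integrable_on {a..r}"
        by (intro integrable_diff iG iH)
      show "(\<lambda>s. (L * norm (Z s - W s) + norm (p s - q s)) + 2 * M * indicat_real S s) integrable_on {a..r}"
        by (intro integrable_add pq_int integrable_on_mult_right iS
            integrable_continuous_real continuous_on_mult_left dc)
      fix s assume s: "s \<in> {a..r}"
      then have s0: "0 \<le> s" using a by auto
      have lip: "norm (F (Z s) (v s) - F (W s) (v s)) \<le> L * norm (Z s - W s)"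
        by (rule F_lip[OF controlsD(1)[OF v(1) s0]])
      have change: "norm (F (Z s) (v' s) - F (Z s) (v s)) \<le> 2 * M * indicat_real S s"
      proof (cases "v' s = v s")
        case False
        then have "s \<in> S" using s r by (auto simp: S_def)
        moreover have "norm (F (Z s) (v' s) - F (Z s) (v s)) \<le> M + M"
          by (intro order_trans[OF norm_triangle_ineq4] add_mono F_bound controlsD s0 v)
        ultimately show ?thesis by simp
      qed (use M1 in auto)
      \<comment> \<open>Same control at two states, difference of the perturbations, and change of
        control at the common state \<open>Z s\<close>. Only the last term sees the replacement; it
        is at most \<open>2 * M\<close> and vanishes off \<open>S\<close>.\<close>
      have split: "vfield v' p s (Z s) - vfield v q s (W s)
          = (F (Z s) (v s) - F (W s) (v s)) + (p s - q s) + (F (Z s) (v' s) - F (Z s) (v s))"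
        by (simp add: vfield_def)
      show "norm (vfield v' p s (Z s) - vfield v q s (W s))
         \<le> (L * norm (Z s - W s) + norm (p s - q s)) + 2 * M * indicat_real S s"
        unfolding split by (intro norm_triangle_mono lip change order_refl)
    qed
    also have "\<dots> = L * integral {a..r} (\<lambda>s. norm (Z s - W s)) + integral {a..r} (\<lambda>s. norm (p s - q s))
        + 2 * M * integral {a..r} (indicat_real S)"
    proof -
      have iL: "(\<lambda>s. L * norm (Z s - W s)) integrable_on {a..r}"
        by (intro integrable_continuous_real continuous_on_mult_left dc)
      show ?thesis
        using iS
        by (simp add: Henstock_Kurzweil_Integration.integral_add[OF integrable_add[OF iL pq_int]]
          Henstock_Kurzweil_Integration.integral_add[OF iL pq_int] integrable_on_mult_right)
    qed
    also have "integral {a..r} (\<lambda>s. norm (p s - q s)) \<le> integral {a..a+h} (\<lambda>s. norm (p s - q s))"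
      using r by (intro integral_subset_le pq_int) auto
    also have "\<dots> \<le> \<kappa>" by (rule \<kappa>)
    also have "integral {a..r} (indicat_real S) \<le> m"
    proof -
      have *: "S \<inter> {a..r} \<in> lmeasurable" using S by (simp add: fmeasurable.Int)
      then have "integral {a..r} (indicat_real S) = measure lebesgue (S \<inter> {a..r})"
        by (rule integral_indicator)
      also have "\<dots> \<le> measure lebesgue S"
        using S * by (intro measure_mono_fmeasurable) (auto dest: fmeasurableD)
      finally show ?thesis using m by (simp add: S_def)
    qed
    finally show "norm (Z r - W r) \<le> d + \<kappa> + 2 * M * m + L * integral {a..r} (\<lambda>s. norm (Z s - W s))"
      using M1 by simp
  qed
  also have "\<dots> \<le> 2 * (d + \<kappa> + 2 * M * m) * 3"
  proof (rule mult_left_mono)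
    have "L * (t - a) \<le> L * h" using t L1 by (intro mult_left_mono) auto
    then have "exp (2 * L * (t - a)) \<le> exp 1" using h(2) by simp
    then show "exp (2 * L * (t - a)) \<le> 3" using exp_le by linarith
  qed (use e0 in simp)
  finally show ?thesis by simp
qed

text \<open>With speed at most \<open>M\<close>, a depth of \<open>M * h\<close> cannot be lost
  within time \<open>h\<close>, whatever control is played.\<close>

lemma stage_far:
  assumes v: "v \<in> controls U" and p: "p \<in> perturbations"
    and a: "0 \<le> a" and t: "t \<in> {a..a+h}" and far: "trajectory (vfield v p) z0 a \<bullet> \<eta> \<le> - M * h"
  shows "trajectory (vfield v p) z0 t \<bullet> \<eta> \<le> 0"
proof -
  let ?Z = "trajectory (vfield v p) z0"
  have "(?Z t - ?Z a) \<bullet> \<eta> \<le> M * (t - a)"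
    using trajectory_increment[OF lipschitz_field_vfield[OF v p] a, of t z0]
      inner_eta_le[of "?Z t - ?Z a"] t by auto
  also have "\<dots> \<le> M * h" using t M1 by (intro mult_left_mono) auto
  finally show ?thesis using far by (simp add: inner_diff_left)
qed

lemma integral_inner_eta:
  "\<phi> integrable_on {a..t} \<Longrightarrow> integral {a..t} \<phi> \<bullet> \<eta> = integral {a..t} (\<lambda>s. \<phi> s \<bullet> \<eta>)"
  "\<phi> integrable_on {a..t} \<Longrightarrow> (\<lambda>s. \<phi> s \<bullet> \<eta>) integrable_on {a..t}"
  for \<phi> :: "real \<Rightarrow> 'a"
  using integral_linear[of \<phi> "{a..t}" "\<lambda>x. x \<bullet> \<eta>"] integrable_linear[of \<phi> "{a..t}" "\<lambda>x. x \<bullet> \<eta>"]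
  by (auto simp: bounded_linear_inner_left o_def)

text \<open>Until the budget is used up, every applied control points inward by a definite amount. Once
  it is used up, the follower has been pushed inward, relative to the leader, by at least
  \<open>c / 4 * bud = 4 * (d + \<kappa>)\<close>, which outweighs the initial distance, the perturbations and the
  Lipschitz drift over the short stage.\<close>

lemma stage_near:
  fixes z0 w0 :: 'a
  assumes v: "v \<in> controls U" "v' \<in> controls U" and p: "p \<in> perturbations" "q \<in> perturbations"
  defines "Z \<equiv> trajectory (vfield v' p) z0" and "W \<equiv> trajectory (vfield v q) w0"
  assumes a: "0 \<le> a" and h: "0 < h" "h * (96 * L * M) \<le> c" and c: "0 < c" "c \<le> 1"
    and d: "norm (Z a - W a) \<le> d"
    and \<kappa>: "integral {a..a+h} (\<lambda>s. norm (p s - q s)) \<le> \<kappa>"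
    and bud: "bud = 16 * (d + \<kappa>) / c"
    and ya: "norm (Z a - y) \<le> M * h"
    and u: "u \<in> U" "\<And>p. p \<in> P \<Longrightarrow> (F y u + p) \<bullet> \<eta> \<le> - c"
  defines "N \<equiv> {s. 0 \<le> s \<and> F y (v s) \<bullet> \<eta> > F y u \<bullet> \<eta> + c / 2}"
  assumes v': "\<And>s. s \<in> {a<..<a+h} \<Longrightarrow>
      v' s = (if s \<in> N \<and> measure lebesgue (N \<inter> {a..s}) \<le> bud then u else v s)"
    and t: "t \<in> {a..a+h}"
  shows "Z a \<bullet> \<eta> \<le> 0 \<Longrightarrow> Z t \<bullet> \<eta> \<le> 0 \<or> Z t \<bullet> \<eta> \<le> W t \<bullet> \<eta>"
    and "measure lebesgue {s \<in> {a..a+h}. v' s \<noteq> v s} \<le> bud"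
proof -
  note G = lipschitz_field_vfield[OF v(2) p(1)] and H = lipschitz_field_vfield[OF v(1) p(2)]
  have Zc: "continuous_on {0..} Z" and Wc: "continuous_on {0..} W"
    unfolding Z_def W_def using trajectory_solution(1) G H by auto
  have N: "N \<in> sets lebesgue"
  proof -
    have "(\<lambda>s. F y (v s)) \<in> borel_measurable (lebesgue_on {0..})"
      by (rule F_measurable[OF continuous_on_const v(1)])
    then have "{s \<in> space (lebesgue_on {0..}). F y (v s) \<bullet> \<eta> > F y u \<bullet> \<eta> + c / 2} \<in> sets (lebesgue_on {0..})"
      by measurable
    then show ?thesis by (subst (asm) sets_restrict_space_iff) (auto simp: N_def)
  qed
  have d0: "0 \<le> d" by (rule order_trans[OF norm_ge_zero d])
  note pq_int = perturbations_diff_integrable[OF p a]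
  have \<kappa>0: "0 \<le> \<kappa>" using \<kappa> integral_nonneg[OF pq_int[of "a+h"]] by auto
  have bud0: "0 \<le> bud" using d0 \<kappa>0 c bud by simp
  have LMh: "L * (M * h) \<le> c / 96" using h(2) by (simp add: mult_ac)
  have "1 * (L * h) \<le> M * (L * h)" using M1 L1 h(1) by (intro mult_right_mono) auto
  then have Lh: "L * h \<le> 1 / 96" using LMh c(2) by (simp add: mult_ac)
  obtain \<theta> where \<theta>: "\<theta> \<in> {a..a+h}"
     "\<And>s. s \<in> {a..a+h} \<Longrightarrow> measure lebesgue (N \<inter> {a..s}) \<le> bud \<longleftrightarrow> s \<le> \<theta>"
     "measure lebesgue (N \<inter> {a..\<theta>}) \<le> bud"
     "bud < measure lebesgue (N \<inter> {a..a+h}) \<Longrightarrow> measure lebesgue (N \<inter> {a..\<theta>}) = bud"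
    using exhaustion_time[OF N _ bud0, of a "a+h"] h(1) by auto
  \<comment> \<open>Up to \<open>\<theta>\<close> every disadvantageous control is replaced; after
    \<open>\<theta>\<close> the leader is copied exactly.\<close>
  have v'\<theta>: "v' s = (if s \<in> N \<and> s \<le> \<theta> then u else v s)" if "s \<in> {a<..<a+h}" for s
    using v'[OF that] \<theta>(2)[of s] that by auto
  have N\<theta>: "N \<inter> {a..\<theta>} \<in> lmeasurable" by (rule lmeasurable_Int_ivl[OF N])
  show m: "measure lebesgue {s \<in> {a..a+h}. v' s \<noteq> v s} \<le> bud"
  proof -
    \<comment> \<open>The controls are related only in the open interval, so the two endpoints are
      added as a null set.\<close>
    have "measure lebesgue {s \<in> {a..a+h}. v' s \<noteq> v s} \<le> measure lebesgue (N \<inter> {a..\<theta>} \<union> {a, a+h})"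
    proof (rule measure_mono_fmeasurable)
      show "{s \<in> {a..a+h}. v' s \<noteq> v s} \<subseteq> N \<inter> {a..\<theta>} \<union> {a, a+h}"
      proof
        fix s assume s: "s \<in> {s \<in> {a..a+h}. v' s \<noteq> v s}"
        show "s \<in> N \<inter> {a..\<theta>} \<union> {a, a+h}"
        proof (cases "s \<in> {a<..<a+h}")
          case True then show ?thesis using s v'\<theta>[OF True] by (auto split: if_splits)
        qed (use s in auto)
      qed
      show "{s \<in> {a..a+h}. v' s \<noteq> v s} \<in> sets lebesgue"
        using controls_neq_sets[OF controlsD(2)[OF v(2)] controlsD(2)[OF v(1)] a] by (rule fmeasurableD)
      show "N \<inter> {a..\<theta>} \<union> {a, a+h} \<in> lmeasurable"
        by (intro fmeasurable.Un N\<theta> lmeasurable_compact) auto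
    qed
    also have "\<dots> = measure lebesgue (N \<inter> {a..\<theta>})"
      by (rule measure_Un_null_set) (use N\<theta> in \<open>auto dest: fmeasurableD simp flip: negligible_iff_null_sets\<close>)
    finally show ?thesis using \<theta>(3) by linarith
  qed
  have dist: "norm (Z s - W s) \<le> 6 * (d + \<kappa> + 2 * M * bud)" if "s \<in> {a..a+h}" for s
    unfolding Z_def W_def
    by (rule stage_distance[OF v p a _ _ d[unfolded Z_def W_def] \<kappa> m that]) (use h Lh in auto)
  have near: "norm (Z s - y) \<le> 2 * (M * h)" if "s \<in> {a..a+h}" for s
  proof -
    have "norm (Z s - Z a) \<le> M * (s - a)"
      unfolding Z_def by (rule trajectory_increment[OF G a]) (use that in auto)
    also have "\<dots> \<le> M * h" using that M1 by (intro mult_left_mono) auto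
    finally show ?thesis using ya norm_triangle_ineq[of "Z s - Z a" "Z a - y"] by simp
  qed
  have Lnear: "L * norm (Z s - y) \<le> c / 48" if "s \<in> {a..a+h}" for s
  proof -
    have "L * norm (Z s - y) \<le> L * (2 * (M * h))"
      using near[OF that] L1 by (intro mult_left_mono) auto
    then show ?thesis using LMh by (simp add: mult.left_commute)
  qed
  have iG: "(\<lambda>s. vfield v' p s (Z s)) integrable_on {a..r}"
   and iH: "(\<lambda>s. vfield v q s (W s)) integrable_on {a..r}" for r
    using lipschitz_field_integrable(2) G H Zc Wc a by blast+
  have at: "a \<le> t" and t0: "{a<..<t} \<subseteq> {a<..<a+h}" using t by auto
  show "Z t \<bullet> \<eta> \<le> 0 \<or> Z t \<bullet> \<eta> \<le> W t \<bullet> \<eta>" if Za: "Z a \<bullet> \<eta> \<le> 0"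
  proof (cases "t \<le> \<theta>")
    case True
    have "integral {a..t} (\<lambda>s. vfield v' p s (Z s) \<bullet> \<eta>) = integral {a<..<t} (\<lambda>s. vfield v' p s (Z s) \<bullet> \<eta>)"
      by (rule integral_open_interval_real)
    also have "\<dots> \<le> integral {a<..<t} (\<lambda>_. 0)"
    proof (rule integral_le)
      show "(\<lambda>s. vfield v' p s (Z s) \<bullet> \<eta>) integrable_on {a<..<t}"
        using integral_inner_eta(2)[OF iG] by (simp add: integrable_on_open_interval_real)
      fix s assume s: "s \<in> {a<..<t}"
      then have sh: "s \<in> {a<..<a+h}" and s0: "0 \<le> s" "s \<in> {a..a+h}" using t0 a t by auto
      have "F y (v' s) \<bullet> \<eta> \<le> F y u \<bullet> \<eta> + c / 2"
        using v'\<theta>[OF sh] s True c s0 by (auto simp: N_def)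
      moreover have "F (Z s) (v' s) \<bullet> \<eta> \<le> F y (v' s) \<bullet> \<eta> + L * norm (Z s - y)"
        by (rule F_inner_lip[OF controlsD(1)[OF v(2) s0(1)]])
      moreover have "F y u \<bullet> \<eta> + p s \<bullet> \<eta> \<le> - c"
        using u(2)[OF perturbationsD(1)[OF p(1) s0(1)]] by (simp add: inner_add_left)
      ultimately show "vfield v' p s (Z s) \<bullet> \<eta> \<le> 0"
        using Lnear[OF s0(2)] c by (simp add: vfield_def inner_add_left)
    qed (rule integrable_0)
    finally have "integral {a..t} (\<lambda>s. vfield v' p s (Z s)) \<bullet> \<eta> \<le> 0"
      by (simp add: integral_inner_eta(1)[OF iG])
    moreover have "Z t = Z a + integral {a..t} (\<lambda>s. vfield v' p s (Z s))"
      unfolding Z_def by (rule trajectory_restart[OF G a at])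
    ultimately show ?thesis using Za by (simp add: inner_add_left)
  next
    case False
    then have \<theta>t: "\<theta> < t" by simp
    \<comment> \<open>A time \<open>t\<close> of the stage beyond \<open>\<theta>\<close> is over
      budget, so by then the replacements have measure exactly \<open>bud\<close>.\<close>
    have mbud: "measure lebesgue (N \<inter> {a..\<theta>}) = bud"
      using \<theta>(2)[of "a+h"] \<theta>(4) \<theta>t t h(1) by auto
    define gap where "gap = 6 * (d + \<kappa> + 2 * M * bud)"
    define I where "I = indicat_real (N \<inter> {a..\<theta>})"
    let ?f = "\<lambda>s. (vfield v' p s (Z s) - vfield v q s (W s)) \<bullet> \<eta>"
    have iI: "I integrable_on {a..t}"
      unfolding I_def integrable_on_indicator
      by (rule fmeasurable_Int_fmeasurable[OF N\<theta>]) simp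
    have bd_int: "(\<lambda>s. (L * gap + norm (p s - q s)) - c / 4 * I s) integrable_on {a..t}"
      by (intro integrable_diff integrable_add integrable_const_ivl pq_int integrable_on_mult_right iI)
    have f_int: "?f integrable_on {a..t}"
      by (intro integral_inner_eta(2) integrable_diff iG iH)
    have "(Z t - W t) \<bullet> \<eta> = (Z a - W a) \<bullet> \<eta> + integral {a..t} ?f"
    proof -
      have "Z t - W t = (Z a - W a) + integral {a..t} (\<lambda>s. vfield v' p s (Z s) - vfield v q s (W s))"
        using trajectory_restart[OF G a at, of z0] trajectory_restart[OF H a at, of w0]
        unfolding Z_def[symmetric] W_def[symmetric]
        by (simp add: Henstock_Kurzweil_Integration.integral_diff[OF iG iH])
      then show ?thesis
        by (simp add: inner_add_left integral_inner_eta(1)[OF integrable_diff[OF iG iH]])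
    qed
    also have "(Z a - W a) \<bullet> \<eta> \<le> d" using inner_eta_le[of "Z a - W a"] d by linarith
    also have "integral {a..t} ?f = integral {a<..<t} ?f" by (rule integral_open_interval_real)
    also have "\<dots> \<le> integral {a<..<t} (\<lambda>s. (L * gap + norm (p s - q s)) - c / 4 * I s)"
    proof (rule integral_le)
      show "?f integrable_on {a<..<t}" "(\<lambda>s. (L * gap + norm (p s - q s)) - c / 4 * I s) integrable_on {a<..<t}"
        using f_int bd_int by (simp_all add: integrable_on_open_interval_real)
      fix s assume s: "s \<in> {a<..<t}"
      then have sh: "s \<in> {a<..<a+h}" and s0: "0 \<le> s" "s \<in> {a..a+h}" using t0 a t by auto
      have "F (Z s) (v s) \<bullet> \<eta> \<le> F (W s) (v s) \<bullet> \<eta> + L * norm (Z s - W s)"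
        by (rule F_inner_lip[OF controlsD(1)[OF v(1) s0(1)]])
      moreover have "L * norm (Z s - W s) \<le> L * gap"
        using dist[OF s0(2)] L1 unfolding gap_def by (intro mult_left_mono) auto
      moreover have "(p s - q s) \<bullet> \<eta> \<le> norm (p s - q s)" by (rule inner_eta_le)
      \<comment> \<open>A replacement gains more than \<open>c / 2\<close> at \<open>y\<close>.
        Moving from \<open>Z s\<close> to \<open>y\<close> and back costs at most
        \<open>c / 48\<close> each way, which leaves more than \<open>c / 4\<close>.\<close>
      moreover have "F (Z s) (v' s) \<bullet> \<eta> \<le> F (Z s) (v s) \<bullet> \<eta> - c / 4 * I s"
      proof (cases "s \<in> N \<and> s \<le> \<theta>")
        case True
        then have "F (Z s) (v' s) \<bullet> \<eta> \<le> F y u \<bullet> \<eta> + L * norm (Z s - y)"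
          using v'\<theta>[OF sh] F_inner_lip[OF u(1)] by simp
        moreover have "F y (v s) \<bullet> \<eta> \<le> F (Z s) (v s) \<bullet> \<eta> + L * norm (y - Z s)"
          by (rule F_inner_lip[OF controlsD(1)[OF v(1) s0(1)]])
        moreover have "F y u \<bullet> \<eta> + c / 2 < F y (v s) \<bullet> \<eta>" using True by (simp add: N_def)
        moreover have "I s = 1" using True s by (simp add: I_def)
        ultimately show ?thesis using Lnear[OF s0(2)] c by (simp add: norm_minus_commute)
      next
        case False
        then show ?thesis using v'\<theta>[OF sh] by (auto simp: I_def)
      qed
      ultimately show "?f s \<le> (L * gap + norm (p s - q s)) - c / 4 * I s"
        by (simp add: vfield_def inner_add_left inner_diff_left)
    qed
    also have "\<dots> = integral {a..t} (\<lambda>s. (L * gap + norm (p s - q s)) - c / 4 * I s)"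
      by (rule integral_open_interval_real[symmetric])
    also have "\<dots> = (t - a) * (L * gap) + integral {a..t} (\<lambda>s. norm (p s - q s)) - c / 4 * integral {a..t} I"
      using at iI
      by (simp add: Henstock_Kurzweil_Integration.integral_diff[OF integrable_add[OF integrable_const_ivl pq_int]]
          Henstock_Kurzweil_Integration.integral_add[OF integrable_const_ivl pq_int] integrable_on_mult_right)
    also have "integral {a..t} (\<lambda>s. norm (p s - q s)) \<le> \<kappa>"
      using integral_subset_le[of "{a..t}" "{a..a+h}", OF _ pq_int pq_int] t \<kappa> by force
    also have "integral {a..t} I = bud"
    proof -
      have "N \<inter> {a..\<theta>} \<inter> {a..t} = N \<inter> {a..\<theta>}" using \<theta>t by auto
      then show ?thesis
        unfolding I_def using integral_indicator[of "N \<inter> {a..\<theta>}" "{a..t}"] N\<theta> mbud by simp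
    qed
    also have "(t - a) * (L * gap) \<le> h * (L * gap)"
      using t L1 d0 \<kappa>0 bud0 M1 by (intro mult_right_mono) (auto simp: gap_def)
    finally have final: "(Z t - W t) \<bullet> \<eta> \<le> d + (h * (L * gap) + \<kappa> - c / 4 * bud)" by simp
    \<comment> \<open>The balance in units of \<open>d + \<kappa>\<close>: since
      \<open>c * bud\<close> is 16 units, the drift is at most 1/16 + 2 units, the initial distance
      and the perturbations together are 1 unit, and the gain is 4 units. The sum is negative or
      zero.\<close>
    have "h * (L * gap) = 6 * ((L * h) * (d + \<kappa>)) + 12 * (L * (M * h) * bud)"
      by (simp add: gap_def algebra_simps)
    also have "(L * h) * (d + \<kappa>) \<le> 1 / 96 * (d + \<kappa>)"
      using Lh d0 \<kappa>0 by (intro mult_right_mono) auto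
    also have "L * (M * h) * bud \<le> c / 96 * bud"
      using LMh bud0 by (intro mult_right_mono) auto
    finally have "h * (L * gap) \<le> (d + \<kappa>) / 16 + c * bud / 8" by (simp add: field_simps)
    moreover have "c * bud / 8 = 2 * (d + \<kappa>)" "c / 4 * bud = 4 * (d + \<kappa>)" using bud c by simp_all
    ultimately have "(Z t - W t) \<bullet> \<eta> \<le> 0" using final d0 \<kappa>0 by argo
    then show ?thesis by (simp add: inner_diff_left)
  qed
qed

section \<open>Concatenation of the stages\<close>

lemma trajectory_vfield_cong:
  assumes "v1 \<in> controls U" "v2 \<in> controls U" "p1 \<in> perturbations" "p2 \<in> perturbations"
    and "AE s in lebesgue_on {0..t}. v1 s = v2 s" "AE s in lebesgue_on {0..t}. p1 s = p2 s"
    and "s \<in> {0..t}"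
  shows "trajectory (vfield v1 p1) z0 s = trajectory (vfield v2 p2) z0 s"
proof (rule trajectory_cong_AE[OF lipschitz_field_vfield lipschitz_field_vfield _ assms(7)])
  show "AE s in lebesgue_on {0..t}. \<forall>z. vfield v1 p1 s z = vfield v2 p2 s z"
    using assms(5,6) by eventually_elim (simp add: vfield_def)
qed (use assms in auto)

text \<open>The rule sees the leader's control and the follower's own perturbation, but not the
  leader's perturbation. For player \<open>X\<close> these inputs are \<open>\<gamma>\<close>
  applied to the tuned control and \<open>D *v \<beta> s\<close>, so joint non-anticipation yields a
  strategy in \<open>\<beta>\<close>.\<close>

definition causal :: "((real \<Rightarrow> 'b) \<Rightarrow> (real \<Rightarrow> 'a) \<Rightarrow> real \<Rightarrow> 'b) \<Rightarrow> bool" where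
  "causal \<Phi> \<longleftrightarrow>
    (\<forall>v\<in>controls U. \<forall>p\<in>perturbations. \<Phi> v p \<in> controls U) \<and>
    (\<forall>t\<ge>0. \<forall>v1\<in>controls U. \<forall>v2\<in>controls U. \<forall>p1\<in>perturbations. \<forall>p2\<in>perturbations.
       (AE s in lebesgue_on {0..t}. v1 s = v2 s) \<longrightarrow> (AE s in lebesgue_on {0..t}. p1 s = p2 s) \<longrightarrow>
       (AE s in lebesgue_on {0..t}. \<Phi> v1 p1 s = \<Phi> v2 p2 s))"

lemma causalD:
  assumes "causal \<Phi>"
  shows "v \<in> controls U \<Longrightarrow> p \<in> perturbations \<Longrightarrow> \<Phi> v p \<in> controls U"
    and "\<lbrakk>t \<ge> 0; v1 \<in> controls U; v2 \<in> controls U; p1 \<in> perturbations; p2 \<in> perturbations;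
      AE s in lebesgue_on {0..t}. v1 s = v2 s; AE s in lebesgue_on {0..t}. p1 s = p2 s\<rbrakk>
      \<Longrightarrow> AE s in lebesgue_on {0..t}. \<Phi> v1 p1 s = \<Phi> v2 p2 s"
  using assms unfolding causal_def by blast+

text \<open>The follower starts at \<open>z0\<close> and is driven by \<open>\<Phi> v p\<close> and \<open>p\<close>; the leader starts at \<open>w0\<close> and is
  driven by \<open>v\<close> and \<open>q\<close>.\<close>

definition follows ::
    "(real \<Rightarrow> real) \<Rightarrow> 'a \<Rightarrow> real \<Rightarrow> real \<Rightarrow> real \<Rightarrow> real \<Rightarrow> ((real \<Rightarrow> 'b) \<Rightarrow> (real \<Rightarrow> 'a) \<Rightarrow> real \<Rightarrow> 'b) \<Rightarrow> bool"
  where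
  "follows \<kappa> z0 \<delta> T d m \<Phi> \<longleftrightarrow>
    (\<forall>v\<in>controls U. \<forall>p\<in>perturbations. \<forall>q\<in>perturbations. \<forall>w0.
      norm (z0 - w0) \<le> \<delta> \<longrightarrow> (\<forall>t\<ge>0. integral {0..t} (\<lambda>s. norm (p s - q s)) \<le> \<kappa> t * \<delta>) \<longrightarrow>
      (\<forall>t\<in>{0..T}.
        ((\<forall>s\<in>{0..t}. trajectory (vfield v q) w0 s \<bullet> \<eta> \<le> 0) \<longrightarrow>
           trajectory (vfield (\<Phi> v p) p) z0 t \<bullet> \<eta> \<le> 0) \<and>
        norm (trajectory (vfield (\<Phi> v p) p) z0 t - trajectory (vfield v q) w0 t) \<le> d * \<delta>) \<and>
      measure lebesgue {s \<in> {0..T}. \<Phi> v p s \<noteq> v s} \<le> m * \<delta>)"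

lemma followsD:
  assumes "follows \<kappa> z0 \<delta> T d m \<Phi>" "v \<in> controls U" "p \<in> perturbations" "q \<in> perturbations"
    "norm (z0 - w0) \<le> \<delta>" "\<forall>t\<ge>0. integral {0..t} (\<lambda>s. norm (p s - q s)) \<le> \<kappa> t * \<delta>"
  shows "\<lbrakk>t \<in> {0..T}; \<And>s. s \<in> {0..t} \<Longrightarrow> trajectory (vfield v q) w0 s \<bullet> \<eta> \<le> 0\<rbrakk>
      \<Longrightarrow> trajectory (vfield (\<Phi> v p) p) z0 t \<bullet> \<eta> \<le> 0"
    and "t \<in> {0..T} \<Longrightarrow>
      norm (trajectory (vfield (\<Phi> v p) p) z0 t - trajectory (vfield v q) w0 t) \<le> d * \<delta>"
    and "measure lebesgue {s \<in> {0..T}. \<Phi> v p s \<noteq> v s} \<le> m * \<delta>"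
  using assms unfolding follows_def by blast+

text \<open>Pythagoras. It keeps the foot point on the hyperplane within the radius for which an
  entering speed is available.\<close>

lemma norm_tangential_part: "norm (x - (x \<bullet> \<eta>) *\<^sub>R \<eta>) \<le> norm x"
proof -
  have "\<eta> \<bullet> \<eta> = 1" using norm_eta by (simp add: dot_square_norm)
  then have "(norm (x - (x \<bullet> \<eta>) *\<^sub>R \<eta>))\<^sup>2 = (norm x)\<^sup>2 - (x \<bullet> \<eta>)\<^sup>2"
    unfolding power2_norm_eq_inner
    by (simp add: inner_diff_left inner_diff_right inner_commute power2_eq_square)
  then have "(norm (x - (x \<bullet> \<eta>) *\<^sub>R \<eta>))\<^sup>2 \<le> (norm x)\<^sup>2" by simp
  then show ?thesis by (rule power2_le_imp_le) simp
qed

text \<open>The position at time \<open>a\<close> is determined by the past. Within distance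
  \<open>M * h\<close> of the hyperplane the budget rule of \<open>stage_near\<close> is applied at
  its orthogonal projection; otherwise the leader is copied and \<open>stage_far\<close> suffices.
  Beyond \<open>a + h\<close> the new rule copies the leader, so the next stage starts from the same
  situation.\<close>

lemma follows_step:
  fixes z0 :: 'a
  assumes \<Phi>: "causal \<Phi>" "follows \<kappa> z0 \<delta> a d m \<Phi>" "\<And>v p s. a \<le> s \<Longrightarrow> \<Phi> v p s = v s"
    and a: "0 \<le> a" and \<delta>: "0 \<le> \<delta>" and d: "0 \<le> d" and c: "0 < c" "c \<le> 1"
    and ent: "\<And>y. y \<bullet> \<eta> = 0 \<Longrightarrow> norm y \<le> norm z0 + M * a \<Longrightarrow>
      \<exists>u\<in>U. \<forall>p\<in>P. (F y u + p) \<bullet> \<eta> \<le> - c"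
    and h: "h = c / (96 * L * M)" and \<kappa>: "0 \<le> \<kappa> (a + h)" and b: "b = 16 * (d + \<kappa> (a + h)) / c"
  obtains \<Phi>' where "causal \<Phi>'"
    "follows \<kappa> z0 \<delta> (a + h) (6 * (d + \<kappa> (a + h) + 2 * M * b)) (m + b) \<Phi>'"
    "\<And>v p s. a + h \<le> s \<Longrightarrow> \<Phi>' v p s = v s" "\<And>v p s. s < a \<Longrightarrow> \<Phi>' v p s = \<Phi> v p s"
proof -
  have h0: "0 < h" and hc: "h * (96 * L * M) \<le> c" using h c L1 M1 by auto
  have "1 * (L * h) \<le> M * (L * h)" using M1 L1 h0 by (intro mult_right_mono) auto
  then have Lh: "L * h \<le> 1 / 2" using hc c(2) by (simp add: mult_ac)
  have b0: "0 \<le> b" using b d \<kappa> c by simp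
  define Z where "Z v p = trajectory (vfield (\<Phi> v p) p) z0 a" for v p
  define y where "y v p = Z v p - (Z v p \<bullet> \<eta>) *\<^sub>R \<eta>" for v p
  \<comment> \<open>The choice depends on \<open>v\<close> and \<open>p\<close> only through the
    projection \<open>y v p\<close>, so equal positions at time \<open>a\<close> select the same
    control.\<close>
  define u where "u v p = (SOME u. u \<in> U \<and> (\<forall>r\<in>P. (F (y v p) u + r) \<bullet> \<eta> \<le> - c))" for v p
  define N where "N v p = {s. 0 \<le> s \<and> F (y v p) (v s) \<bullet> \<eta> > F (y v p) (u v p) \<bullet> \<eta> + c / 2}" for v p
  define near where "near v p \<longleftrightarrow> norm (Z v p - y v p) \<le> M * h" for v p
  \<comment> \<open>The half-open interval makes \<open>\<Phi>'\<close> agree with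
    \<open>\<Phi>\<close> before \<open>a\<close> and with \<open>v\<close> from
    \<open>a + h\<close> on at every time, not just almost everywhere.\<close>
  define Q where "Q v p = {s. near v p \<and> a \<le> s \<and> s < a + h \<and> s \<in> N v p
      \<and> measure lebesgue (N v p \<inter> {a..s}) \<le> b * \<delta>}" for v p
  define \<Phi>' where "\<Phi>' v p s = (if s \<in> Q v p then u v p else \<Phi> v p s)" for v p s
  have norm_Z: "norm (Z v p) \<le> norm z0 + M * a" if "v \<in> controls U" "p \<in> perturbations" for v p
  proof -
    note G = lipschitz_field_vfield[OF causalD(1)[OF \<Phi>(1) that] that(2)]
    have "norm (Z v p - z0) \<le> M * a"
      using trajectory_increment[OF G order_refl a, of z0] trajectory_0[OF G] by (simp add: Z_def)
    then show ?thesis using norm_triangle_sub[of "Z v p" z0] by simp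
  qed
  have u: "u v p \<in> U" "\<And>r. r \<in> P \<Longrightarrow> (F (y v p) (u v p) + r) \<bullet> \<eta> \<le> - c"
    if "v \<in> controls U" "p \<in> perturbations" for v p
  proof -
    have "y v p \<bullet> \<eta> = 0"
      using norm_eta by (simp add: y_def inner_diff_left dot_square_norm)
    moreover have "norm (y v p) \<le> norm z0 + M * a"
      using norm_tangential_part[of "Z v p"] norm_Z[OF that] by (simp add: y_def)
    ultimately have "\<exists>u. u \<in> U \<and> (\<forall>r\<in>P. (F (y v p) u + r) \<bullet> \<eta> \<le> - c)" using ent by blast
    from someI_ex[OF this] show "u v p \<in> U" "\<And>r. r \<in> P \<Longrightarrow> (F (y v p) (u v p) + r) \<bullet> \<eta> \<le> - c"
      unfolding u_def by auto
  qed
  have N: "N v p \<in> sets lebesgue" if "v \<in> controls U" for v p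
  proof -
    have "(\<lambda>s. F (y v p) (v s)) \<in> borel_measurable (lebesgue_on {0..})"
      by (rule F_measurable[OF continuous_on_const that])
    then have "{s \<in> space (lebesgue_on {0..}). F (y v p) (v s) \<bullet> \<eta> > F (y v p) (u v p) \<bullet> \<eta> + c / 2}
        \<in> sets (lebesgue_on {0..})"
      by measurable
    then show ?thesis by (subst (asm) sets_restrict_space_iff) (auto simp: N_def)
  qed
  have Q: "Q v p \<in> sets lebesgue" if v: "v \<in> controls U" for v p
  proof (cases "near v p")
    case True
    obtain \<theta> where \<theta>: "\<And>s. s \<in> {a..a+h} \<Longrightarrow> measure lebesgue (N v p \<inter> {a..s}) \<le> b * \<delta> \<longleftrightarrow> s \<le> \<theta>"
      by (rule exhaustion_time[OF N[OF v, of p], of a "a+h" "b * \<delta>"]) (use h0 b0 \<delta> in auto)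
    \<comment> \<open>Measurability: the budget test amounts to
      \<open>s \<le> \<theta>\<close>.\<close>
    have "Q v p = N v p \<inter> ({a..<a+h} \<inter> {..\<theta>})" using True \<theta> by (auto simp: Q_def)
    then show ?thesis using N[OF v] by auto
  next
    case False
    then have "Q v p = {}" by (simp add: Q_def)
    then show ?thesis by simp
  qed
  have old: "\<Phi>' v p s = \<Phi> v p s" if "s < a" for v p s
    using that by (simp add: \<Phi>'_def Q_def)
  have new: "\<Phi>' v p s = v s" if "a + h \<le> s" for v p s
    using that \<Phi>(3) h0 by (simp add: \<Phi>'_def Q_def)
  have ctrl: "\<Phi>' v p \<in> controls U" if v: "v \<in> controls U" and p: "p \<in> perturbations" for v p
  proof -
    note \<Phi>c = causalD(1)[OF \<Phi>(1) v p]
    have "Q v p \<inter> space (lebesgue_on {0..}) \<in> sets (lebesgue_on {0..})"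
      using Q[OF v] by (subst sets_restrict_space_iff) auto
    then have "\<Phi>' v p \<in> borel_measurable (lebesgue_on {0..})"
      unfolding \<Phi>'_def using controlsD(2)[OF \<Phi>c]
      by (intro measurable_If_set) auto
    moreover have "\<Phi>' v p \<in> {0..} \<rightarrow>\<^sub>E U"
    proof (rule PiE_I)
      show "\<Phi>' v p s \<in> U" if "s \<in> {0..}" for s
        using that u(1)[OF v p] controlsD(1)[OF \<Phi>c] by (simp add: \<Phi>'_def)
      show "\<Phi>' v p s = undefined" if "s \<notin> {0..}" for s
        using that a old[of s v p] \<Phi>c by (auto simp: controls_def PiE_def extensional_def)
    qed
    ultimately show ?thesis by (simp add: controls_def)
  qed
  have "causal \<Phi>'"
    unfolding causal_def
  proof (intro conjI ballI allI impI)
    fix t :: real and v1 v2 p1 p2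
    assume t: "0 \<le> t" and v: "v1 \<in> controls U" "v2 \<in> controls U"
      and p: "p1 \<in> perturbations" "p2 \<in> perturbations"
      and ae: "AE s in lebesgue_on {0..t}. v1 s = v2 s" "AE s in lebesgue_on {0..t}. p1 s = p2 s"
    have ae\<Phi>: "AE s in lebesgue_on {0..t}. \<Phi> v1 p1 s = \<Phi> v2 p2 s"
      by (rule causalD(2)[OF \<Phi>(1) t v p ae])
    show "AE s in lebesgue_on {0..t}. \<Phi>' v1 p1 s = \<Phi>' v2 p2 s"
    proof (cases "t < a")
      case True
      then show ?thesis
        using ae\<Phi> unfolding AE_lebesgue_on_ivl_iff by eventually_elim (use True in \<open>auto simp: old\<close>)
    next
      case False
      then have at: "a \<le> t" by simp
      have "Z v1 p1 = Z v2 p2"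
        unfolding Z_def
        by (rule trajectory_vfield_cong[OF causalD(1)[OF \<Phi>(1) v(1) p(1)] causalD(1)[OF \<Phi>(1) v(2) p(2)] p
           AE_lebesgue_on_ivl_mono[OF ae\<Phi> at] AE_lebesgue_on_ivl_mono[OF ae(2) at]]) (use a in auto)
      then have y: "y v1 p1 = y v2 p2" and n: "near v1 p1 = near v2 p2"
        by (simp_all add: y_def near_def)
      then have uu: "u v1 p1 = u v2 p2" by (simp add: u_def)
      have aeN: "AE s in lebesgue_on {0..t}. s \<in> N v1 p1 \<longleftrightarrow> s \<in> N v2 p2"
        using ae(1) by eventually_elim (simp add: N_def y uu)
      \<comment> \<open>The two sets agree only almost everywhere up to \<open>t\<close>, but the
        budget test sees only their measures, and these are equal at each
        \<open>s \<le> t\<close>.\<close>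
      have meas: "measure lebesgue (N v1 p1 \<inter> {a..s}) = measure lebesgue (N v2 p2 \<inter> {a..s})"
        if "s \<le> t" for s
      proof (rule measure_eq_AE)
        show "AE r in lebesgue. (r \<in> N v1 p1 \<inter> {a..s}) = (r \<in> N v2 p2 \<inter> {a..s})"
          using aeN unfolding AE_lebesgue_on_ivl_iff by eventually_elim (use that a in auto)
      qed (use N v in auto)
      show ?thesis
        using aeN ae\<Phi> unfolding AE_lebesgue_on_ivl_iff
        by eventually_elim (auto simp: \<Phi>'_def Q_def n uu meas)
    qed
  qed (rule ctrl)
  moreover have "follows \<kappa> z0 \<delta> (a + h) (6 * (d + \<kappa> (a + h) + 2 * M * b)) (m + b) \<Phi>'"
    unfolding follows_def
  proof (intro ballI allI impI)
    fix v p q w0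
    assume v: "v \<in> controls U" and p: "p \<in> perturbations" and q: "q \<in> perturbations"
      and w0: "norm (z0 - w0) \<le> \<delta>"
      and pq: "\<forall>t\<ge>0. integral {0..t} (\<lambda>s. norm (p s - q s)) \<le> \<kappa> t * \<delta>"
    let ?v' = "\<Phi>' v p"
    let ?Z = "trajectory (vfield ?v' p) z0" and ?W = "trajectory (vfield v q) w0"
    note v' = ctrl[OF v p]
    note IH = followsD[OF \<Phi>(2) v p q w0 pq]
    note \<Phi>c = causalD(1)[OF \<Phi>(1) v p]
    have agree: "?Z t = trajectory (vfield (\<Phi> v p) p) z0 t" if "t \<in> {0..a}" for t
      by (rule trajectory_vfield_cong[OF v' \<Phi>c p p _ _ that])
         (auto intro!: AE_lebesgue_on_ivlI simp: old)
    then have Za: "?Z a = Z v p" using a by (simp add: Z_def)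
    have da: "norm (?Z a - ?W a) \<le> d * \<delta>" using IH(2)[of a] agree[of a] a by simp
    have \<kappa>a: "integral {a..a+h} (\<lambda>s. norm (p s - q s)) \<le> \<kappa> (a + h) * \<delta>"
      using integral_subset_le[of "{a..a+h}" "{0..a+h}", OF _ perturbations_diff_integrable[OF p q a]
          perturbations_diff_integrable[OF p q order_refl]] pq[rule_format, of "a+h"] a h0 by force
    have stage: "(?Z a \<bullet> \<eta> \<le> 0 \<longrightarrow> ?Z t \<bullet> \<eta> \<le> 0 \<or> ?Z t \<bullet> \<eta> \<le> ?W t \<bullet> \<eta>) \<and>
        measure lebesgue {s \<in> {a..a+h}. ?v' s \<noteq> v s} \<le> b * \<delta>" if t: "t \<in> {a..a+h}" for t
    proof (cases "near v p")
      case True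
      have v'N: "?v' s = (if s \<in> {s. 0 \<le> s \<and> F (y v p) (v s) \<bullet> \<eta> > F (y v p) (u v p) \<bullet> \<eta> + c / 2} \<and>
          measure lebesgue ({s. 0 \<le> s \<and> F (y v p) (v s) \<bullet> \<eta> > F (y v p) (u v p) \<bullet> \<eta> + c / 2} \<inter> {a..s})
            \<le> b * \<delta> then u v p else v s)" if "s \<in> {a<..<a+h}" for s
        unfolding N_def[symmetric] using that True \<Phi>(3)[of s v p] by (auto simp: \<Phi>'_def Q_def)
      have ya: "norm (?Z a - y v p) \<le> M * h" using True by (simp add: near_def Za)
      have bud: "b * \<delta> = 16 * (d * \<delta> + \<kappa> (a + h) * \<delta>) / c" by (simp add: b algebra_simps)
      note S = stage_near[OF v v' p q a h0 hc c da \<kappa>a bud ya u(1)[OF v p] u(2)[OF v p] v'N t]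
      show ?thesis using S by blast
    next
      case False
      then have v'v: "?v' s = v s" if "s \<in> {a..a+h}" for s
        using that \<Phi>(3)[of s v p] by (auto simp: \<Phi>'_def Q_def)
      then have "{s \<in> {a..a+h}. ?v' s \<noteq> v s} = {}" by auto
      then have "measure lebesgue {s \<in> {a..a+h}. ?v' s \<noteq> v s} = 0" by (simp only: measure_empty)
      moreover have "?Z t \<bullet> \<eta> \<le> 0" if "?Z a \<bullet> \<eta> \<le> 0"
      proof (rule stage_far[OF v' p a t])
        \<comment> \<open>The distance to the projection is the absolute normal component, as
          \<open>\<eta>\<close> is a unit vector; inside the half-space this means depth greater
          than \<open>M * h\<close>.\<close>
        have "\<bar>?Z a \<bullet> \<eta>\<bar> > M * h" using False norm_eta by (simp add: near_def y_def Za)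
        then show "?Z a \<bullet> \<eta> \<le> - M * h" using that by simp
      qed
      ultimately show ?thesis using b0 \<delta> by simp
    qed
    have dist: "norm (?Z t - ?W t) \<le> 6 * (d + \<kappa> (a + h) + 2 * M * b) * \<delta>" if "t \<in> {a..a+h}" for t
    proof -
      have "norm (?Z t - ?W t) \<le> 6 * (d * \<delta> + \<kappa> (a + h) * \<delta> + 2 * M * (b * \<delta>))"
        using stage[of a] h0
        by (intro stage_distance[OF v v' p q a _ Lh da \<kappa>a _ that]) auto
      then show ?thesis by (simp add: algebra_simps)
    qed
    have dmono: "d * \<delta> \<le> 6 * (d + \<kappa> (a + h) + 2 * M * b) * \<delta>"
      using d \<kappa> b0 M1 \<delta> by (intro mult_right_mono) auto
    show "(\<forall>t\<in>{0..a+h}. ((\<forall>s\<in>{0..t}. ?W s \<bullet> \<eta> \<le> 0) \<longrightarrow> ?Z t \<bullet> \<eta> \<le> 0) \<and>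
        norm (?Z t - ?W t) \<le> 6 * (d + \<kappa> (a + h) + 2 * M * b) * \<delta>) \<and>
      measure lebesgue {s \<in> {0..a+h}. ?v' s \<noteq> v s} \<le> (m + b) * \<delta>"
    proof (intro conjI ballI impI)
      fix t assume t: "t \<in> {0..a+h}"
      show "norm (?Z t - ?W t) \<le> 6 * (d + \<kappa> (a + h) + 2 * M * b) * \<delta>"
        using dist[of t] IH(2)[of t] agree[of t] dmono t by (cases "t \<le> a") force+
      assume W: "\<forall>s\<in>{0..t}. ?W s \<bullet> \<eta> \<le> 0"
      show "?Z t \<bullet> \<eta> \<le> 0"
      proof (cases "t \<le> a")
        case True
        then show ?thesis using IH(1)[of t] W agree[of t] t by simp
      next
        case False
        then have "?Z a \<bullet> \<eta> \<le> 0" using IH(1)[of a] W agree[of a] a by simp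
        then show ?thesis using stage[of t] W False t by force
      qed
    next
      have "measure lebesgue {s \<in> {0..a+h}. ?v' s \<noteq> v s}
        \<le> measure lebesgue (({s \<in> {0..a}. \<Phi> v p s \<noteq> v s} \<union> {s \<in> {a..a+h}. ?v' s \<noteq> v s}))"
      proof (rule measure_mono_fmeasurable)
        show "{s \<in> {0..a+h}. ?v' s \<noteq> v s} \<subseteq> {s \<in> {0..a}. \<Phi> v p s \<noteq> v s} \<union> {s \<in> {a..a+h}. ?v' s \<noteq> v s}"
        proof
          fix s assume "s \<in> {s \<in> {0..a+h}. ?v' s \<noteq> v s}"
          then show "s \<in> {s \<in> {0..a}. \<Phi> v p s \<noteq> v s} \<union> {s \<in> {a..a+h}. ?v' s \<noteq> v s}"
            using old[of s v p] by (cases "s < a") auto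
        qed
        show "{s \<in> {0..a+h}. ?v' s \<noteq> v s} \<in> sets lebesgue"
          by (intro fmeasurableD controls_neq_sets controlsD(2)[of _ U] v v') simp
        show "{s \<in> {0..a}. \<Phi> v p s \<noteq> v s} \<union> {s \<in> {a..a+h}. ?v' s \<noteq> v s} \<in> lmeasurable"
          by (intro fmeasurable.Un controls_neq_sets controlsD(2)[of _ U] v v' \<Phi>c a order_refl)
      qed
      also have "\<dots> \<le> measure lebesgue {s \<in> {0..a}. \<Phi> v p s \<noteq> v s}
          + measure lebesgue {s \<in> {a..a+h}. ?v' s \<noteq> v s}"
        by (intro measure_Un_le fmeasurableD controls_neq_sets controlsD(2)[of _ U] v v' \<Phi>c a order_refl)
      also have "\<dots> \<le> m * \<delta> + b * \<delta>" using IH(3) stage[of a] h0 by (intro add_mono) auto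
      finally show "measure lebesgue {s \<in> {0..a+h}. ?v' s \<noteq> v s} \<le> (m + b) * \<delta>"
        by (simp add: algebra_simps)
    qed
  qed
  ultimately show ?thesis using that[of \<Phi>'] new old by blast
qed

text \<open>Iteration of \<open>follows_step\<close>. All errors are multiples of
  \<open>\<delta>\<close>, so \<open>C\<close> depends neither on \<open>\<delta>\<close> nor on the
  initial point within radius \<open>R\<close>. One rule serves all horizons, because exit times are
  later compared without truncation.\<close>

lemma follower_exists:
  fixes R :: real and \<kappa> :: "real \<Rightarrow> real"
  assumes \<kappa>: "\<And>t. 0 \<le> \<kappa> t"
  obtains C :: "real \<Rightarrow> real" where "\<And>T. 0 \<le> C T"
    and "\<And>z0 \<delta>. norm z0 \<le> R \<Longrightarrow> z0 \<bullet> \<eta> \<le> 0 \<Longrightarrow> 0 \<le> \<delta> \<Longrightarrow>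
      \<exists>\<Phi>. causal \<Phi> \<and> (\<forall>T. follows \<kappa> z0 \<delta> T (C T) (C T) \<Phi>)"
proof -
  obtain rate :: "real \<Rightarrow> real" where rate: "antimono rate" "\<And>r. 0 < rate r" "\<And>r. rate r \<le> 1"
    "\<And>r y. y \<bullet> \<eta> = 0 \<Longrightarrow> norm y \<le> r \<Longrightarrow> \<exists>u\<in>U. \<forall>p\<in>P. (F y u + p) \<bullet> \<eta> \<le> - rate r"
    using entering_rate by blast
  define c where "c t = rate (R + M * t)" for t
  define h where "h t = c t / (96 * L * M)" for t
  \<comment> \<open>Stage endpoints. Positions reached by time \<open>t\<close> have norm at most
    \<open>R + M * t\<close>, which fixes the rate and thus the length of the stage starting at
    \<open>t\<close>.\<close>
  define \<tau> where "\<tau> = rec_nat 0 (\<lambda>_ t. t + h t)"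
  have \<tau>: "\<tau> 0 = 0" "\<And>n. \<tau> (Suc n) = \<tau> n + h (\<tau> n)" by (simp_all add: \<tau>_def)
  \<comment> \<open>Distances are counted in multiples of \<open>\<delta>\<close>, so the initial
    bound is 1.\<close>
  define d where "d = rec_nat 1 (\<lambda>n d. 6 * (d + \<kappa> (\<tau> (Suc n)) + 2 * M * (16 * (d + \<kappa> (\<tau> (Suc n))) / c (\<tau> n))))"
  define b where "b n = 16 * (d n + \<kappa> (\<tau> (Suc n))) / c (\<tau> n)" for n
  define m where "m n = (\<Sum>i<n. b i)" for n
  have d: "d 0 = 1" "\<And>n. d (Suc n) = 6 * (d n + \<kappa> (\<tau> (Suc n)) + 2 * M * b n)"
    by (simp_all add: d_def b_def)
  have c0: "0 < c t" for t using rate(2) by (simp add: c_def)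
  have h0: "0 < h t" for t using c0[of t] L1 M1 by (simp add: h_def)
  have d0: "0 \<le> d n" for n
  proof (induction n)
    case (Suc n)
    then have "0 \<le> b n" using \<kappa> c0[of "\<tau> n"] by (simp add: b_def)
    then show ?case using Suc \<kappa> M1 by (simp add: d)
  qed (simp add: d)
  have b0: "0 \<le> b n" for n using \<kappa> c0[of "\<tau> n"] d0 by (simp add: b_def)
  have m0: "0 \<le> m n" for n unfolding m_def by (intro sum_nonneg b0)
  have \<tau>0: "0 \<le> \<tau> n" for n
    using h0 by (induction n) (auto simp: \<tau> intro: add_nonneg_nonneg less_imp_le)
  have \<tau>_mono: "mono \<tau>" by (rule incseq_SucI) (simp add: \<tau> less_imp_le h0)
  \<comment> \<open>If all endpoints stayed below \<open>T\<close>, monotonicity of the rate would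
    make each stage at least \<open>h T\<close> long, a contradiction.\<close>
  have unbounded: "\<exists>n. T < \<tau> n" for T
  proof (rule ccontr)
    assume "\<not> (\<exists>n. T < \<tau> n)"
    then have le: "\<tau> n \<le> T" for n by (meson not_less)
    have "h T \<le> h (\<tau> n)" for n
      unfolding h_def c_def using le[of n] M1 L1
      by (intro divide_right_mono antimonoD[OF rate(1)] add_left_mono mult_left_mono) auto
    then have "real n * h T \<le> \<tau> n" for n
    proof (induction n)
      case (Suc n)
      then have "real n * h T + h T \<le> \<tau> n + h (\<tau> n)" by (intro add_mono) auto
      then show ?case by (simp add: \<tau> algebra_simps)
    qed (simp add: \<tau>)
    moreover obtain n where "T < real n * h T" using ex_less_of_nat_mult[OF h0] by blast
    ultimately show False using le[of n] by (meson not_less order_trans)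
  qed
  define idx where "idx T = (LEAST n. T < \<tau> n)" for T
  have idx: "T < \<tau> (idx T)" for T unfolding idx_def using unbounded[of T] by (rule LeastI_ex)
  define C where "C T = d (idx T) + m (idx T)" for T
  show ?thesis
  proof (rule that[of C])
    show "0 \<le> C T" for T using d0 m0 by (simp add: C_def)
    fix z0 :: 'a and \<delta> :: real
    assume z0: "norm z0 \<le> R" "z0 \<bullet> \<eta> \<le> 0" and \<delta>: "0 \<le> \<delta>"
    define good where "good n \<Phi> \<longleftrightarrow> causal \<Phi> \<and> follows \<kappa> z0 \<delta> (\<tau> n) (d n) (m n) \<Phi> \<and>
       (\<forall>v p s. \<tau> n \<le> s \<longrightarrow> \<Phi> v p s = v s)" for n \<Phi>
    \<comment> \<open>Dependent choice rather than a separate choice for each \<open>n\<close>: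
      every rule must extend the previous one.\<close>
    have "\<exists>\<Phi>. \<forall>n. good n (\<Phi> n) \<and> (\<forall>v p s. s < \<tau> n \<longrightarrow> \<Phi> (Suc n) v p s = \<Phi> n v p s)"
    proof (rule dependent_nat_choice)
      have "good 0 (\<lambda>v p. v)"
        unfolding good_def
      proof (intro conjI allI impI)
        show "causal (\<lambda>v p. v)" by (simp add: causal_def)
        show "follows \<kappa> z0 \<delta> (\<tau> 0) (d 0) (m 0) (\<lambda>v p. v)"
          unfolding follows_def
          using z0(2) by (auto simp: \<tau> d m_def trajectory_0[OF lipschitz_field_vfield])
      qed auto
      then show "\<exists>\<Phi>. good 0 \<Phi>" by blast
      fix \<Phi> n assume "good n \<Phi>"
      then have \<Phi>: "causal \<Phi>" "follows \<kappa> z0 \<delta> (\<tau> n) (d n) (m n) \<Phi>"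
        "\<And>v p s. \<tau> n \<le> s \<Longrightarrow> \<Phi> v p s = v s"
        unfolding good_def by blast+
      have ent: "\<exists>u\<in>U. \<forall>p\<in>P. (F y u + p) \<bullet> \<eta> \<le> - c (\<tau> n)"
        if "y \<bullet> \<eta> = 0" "norm y \<le> norm z0 + M * \<tau> n" for y
        unfolding c_def using that z0 by (intro rate(4)) auto
      have "c (\<tau> n) \<le> 1" using rate(3) by (simp add: c_def)
      moreover have "0 \<le> \<kappa> (\<tau> n + h (\<tau> n))" by (rule \<kappa>)
      moreover have "b n = 16 * (d n + \<kappa> (\<tau> n + h (\<tau> n))) / c (\<tau> n)" by (simp add: b_def \<tau>)
      ultimately obtain \<Phi>' where "causal \<Phi>'"
         "follows \<kappa> z0 \<delta> (\<tau> n + h (\<tau> n)) (6 * (d n + \<kappa> (\<tau> n + h (\<tau> n)) + 2 * M * b n)) (m n + b n) \<Phi>'"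
         "\<And>v p s. \<tau> n + h (\<tau> n) \<le> s \<Longrightarrow> \<Phi>' v p s = v s" "\<And>v p s. s < \<tau> n \<Longrightarrow> \<Phi>' v p s = \<Phi> v p s"
        using follows_step[OF \<Phi> \<tau>0 \<delta> d0 c0 _ ent h_def] by blast
      then show "\<exists>\<Phi>'. good (Suc n) \<Phi>' \<and> (\<forall>v p s. s < \<tau> n \<longrightarrow> \<Phi>' v p s = \<Phi> v p s)"
        unfolding good_def \<tau>(2) d(2) by (intro exI[of _ \<Phi>']) (simp add: m_def)
    qed
    then obtain \<Phi> where good: "\<And>n. good n (\<Phi> n)"
      and extend: "\<And>n v p s. s < \<tau> n \<Longrightarrow> \<Phi> (Suc n) v p s = \<Phi> n v p s" by blast
    \<comment> \<open>At time \<open>s\<close> the glued rule uses the first stage ending strictly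
      after \<open>s\<close>; by \<open>stable\<close> any later stage gives the same value.
      Negative times fall under stage 0.\<close>
    define \<Psi> where "\<Psi> v p s = \<Phi> (idx s) v p s" for v p s
    have stable: "\<Phi> n v p s = \<Phi> k v p s" if "s < \<tau> k" "k \<le> n" for n k v p s
      using that(2)
    proof (induction n rule: dec_induct)
      case (step i)
      then show ?case using \<open>s < \<tau> k\<close> monoD[OF \<tau>_mono, of k i]
        by (simp add: extend)
    qed simp
    have \<Psi>: "\<Psi> v p s = \<Phi> n v p s" if "s < \<tau> n" for n v p s
    proof -
      have "idx s \<le> n" unfolding idx_def using that by (rule Least_le)
      then show ?thesis unfolding \<Psi>_def by (rule stable[OF idx, symmetric])
    qed
    have \<Phi>c: "\<Phi> n v p \<in> controls U" if "v \<in> controls U" "p \<in> perturbations" for n v p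
      using good[of n] that causalD(1) unfolding good_def by blast
    have \<Psi>c: "\<Psi> v p \<in> controls U" if v: "v \<in> controls U" and p: "p \<in> perturbations" for v p
    proof -
      have "\<Psi> v p \<in> borel_measurable (lebesgue_on {0..})"
      proof (rule borel_measurable_LIMSEQ_metric)
        show "\<Phi> n v p \<in> borel_measurable (lebesgue_on {0..})" for n
          by (rule controlsD(2)[OF \<Phi>c[OF v p]])
        fix s :: real
        have "eventually (\<lambda>n. \<Phi> n v p s = \<Psi> v p s) sequentially"
          unfolding \<Psi>_def
          by (rule eventually_mono[OF eventually_ge_at_top[of "idx s"]]) (rule stable[OF idx])
        then show "(\<lambda>n. \<Phi> n v p s) \<longlonglongrightarrow> \<Psi> v p s" by (rule tendsto_eventually)
      qed
      moreover have "\<Psi> v p \<in> {0..} \<rightarrow>\<^sub>E U"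
      proof (rule PiE_I)
        show "\<Psi> v p s \<in> U" if "s \<in> {0..}" for s
          unfolding \<Psi>_def using that by (intro controlsD(1)[OF \<Phi>c[OF v p]]) simp
        show "\<Psi> v p s = undefined" if "s \<notin> {0..}" for s
          unfolding \<Psi>_def using that \<Phi>c[OF v p, of "idx s"]
          by (simp add: controls_def PiE_def extensional_def)
      qed
      ultimately show ?thesis by (simp add: controls_def)
    qed
    have "causal \<Psi>"
      unfolding causal_def
    proof (intro conjI ballI allI impI \<Psi>c)
      fix t :: real and v1 v2 p1 p2
      assume *: "0 \<le> t" "v1 \<in> controls U" "v2 \<in> controls U" "p1 \<in> perturbations" "p2 \<in> perturbations"
        "AE s in lebesgue_on {0..t}. v1 s = v2 s" "AE s in lebesgue_on {0..t}. p1 s = p2 s"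
      have "causal (\<Phi> (idx t))" using good unfolding good_def by blast
      from causalD(2)[OF this *] show "AE s in lebesgue_on {0..t}. \<Psi> v1 p1 s = \<Psi> v2 p2 s"
        unfolding AE_lebesgue_on_ivl_iff
        by (rule eventually_mono) (auto simp: \<Psi>[OF order_le_less_trans[OF _ idx[of t]]])
    qed
    moreover have "follows \<kappa> z0 \<delta> T (C T) (C T) \<Psi>" for T
      unfolding follows_def
    proof (intro ballI allI impI)
      fix v p q w0
      assume v: "v \<in> controls U" and p: "p \<in> perturbations" and q: "q \<in> perturbations"
        and w0: "norm (z0 - w0) \<le> \<delta>"
        and pq: "\<forall>t\<ge>0. integral {0..t} (\<lambda>s. norm (p s - q s)) \<le> \<kappa> t * \<delta>"
      let ?i = "idx T" and ?W = "trajectory (vfield v q) w0"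
      let ?Z = "trajectory (vfield (\<Psi> v p) p) z0"
      have f: "follows \<kappa> z0 \<delta> (\<tau> ?i) (d ?i) (m ?i) (\<Phi> ?i)" using good unfolding good_def by blast
      note IH = followsD[OF f v p q w0 pq]
      have eq: "\<Psi> v p s = \<Phi> ?i v p s" if "s \<le> T" for s
        by (rule \<Psi>[OF order_le_less_trans[OF that idx]])
      have agree: "?Z t = trajectory (vfield (\<Phi> ?i v p) p) z0 t" if "t \<in> {0..T}" for t
        by (rule trajectory_vfield_cong[OF \<Psi>c[OF v p] \<Phi>c[OF v p] p p _ _ that])
           (auto intro!: AE_lebesgue_on_ivlI simp: eq)
      have C: "d ?i * \<delta> \<le> C T * \<delta>" "m ?i * \<delta> \<le> C T * \<delta>"
        using d0 m0 \<delta> by (auto simp: C_def intro!: mult_right_mono)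
      have sub: "t \<in> {0..\<tau> ?i}" if "t \<in> {0..T}" for t using that idx[of T] by auto
      have "{s \<in> {0..T}. \<Psi> v p s \<noteq> v s} = {s \<in> {0..T}. \<Phi> ?i v p s \<noteq> v s}" using eq by auto
      also have "measure lebesgue \<dots> \<le> measure lebesgue {s \<in> {0..\<tau> ?i}. \<Phi> ?i v p s \<noteq> v s}"
      proof (rule measure_mono_fmeasurable)
        show "{s \<in> {0..T}. \<Phi> ?i v p s \<noteq> v s} \<subseteq> {s \<in> {0..\<tau> ?i}. \<Phi> ?i v p s \<noteq> v s}" using sub by auto
        show "{s \<in> {0..T}. \<Phi> ?i v p s \<noteq> v s} \<in> sets lebesgue"
          by (intro fmeasurableD controls_neq_sets controlsD(2)[of _ U] v \<Phi>c p order_refl)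
        show "{s \<in> {0..\<tau> ?i}. \<Phi> ?i v p s \<noteq> v s} \<in> lmeasurable"
          by (intro controls_neq_sets controlsD(2)[of _ U] v \<Phi>c p order_refl)
      qed
      finally have "measure lebesgue {s \<in> {0..T}. \<Psi> v p s \<noteq> v s} \<le> C T * \<delta>"
        using IH(3) C(2) by linarith
      moreover have "?Z t \<bullet> \<eta> \<le> 0" if "t \<in> {0..T}" "\<forall>s\<in>{0..t}. ?W s \<bullet> \<eta> \<le> 0" for t
        using IH(1)[OF sub[OF that(1)]] that agree[OF that(1)] by simp
      moreover have "norm (?Z t - ?W t) \<le> C T * \<delta>" if "t \<in> {0..T}" for t
        using IH(2)[OF sub[OF that]] agree[OF that] C(1) by simp
      ultimately show "(\<forall>t\<in>{0..T}. ((\<forall>s\<in>{0..t}. ?W s \<bullet> \<eta> \<le> 0) \<longrightarrow> ?Z t \<bullet> \<eta> \<le> 0) \<and>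
          norm (?Z t - ?W t) \<le> C T * \<delta>) \<and>
        measure lebesgue {s \<in> {0..T}. \<Psi> v p s \<noteq> v s} \<le> C T * \<delta>" by blast
    qed
    ultimately show "\<exists>\<Phi>. causal \<Phi> \<and> (\<forall>T. follows \<kappa> z0 \<delta> T (C T) (C T) \<Phi>)" by blast
  qed
qed

end

section \<open>Exit times, costs and the two players\<close>

lemma open_halfspace_facts:
  assumes "norm \<eta> = 1"
  shows "closure (open_halfspace \<eta>) = {x. x \<bullet> \<eta> \<le> 0}" "frontier (open_halfspace \<eta>) = {x. x \<bullet> \<eta> = 0}"
proof -
  have "\<eta> \<noteq> 0" using assms by auto
  moreover have "open_halfspace \<eta> = {x. \<eta> \<bullet> x < 0}" by (simp add: open_halfspace_def inner_commute)
  ultimately show "closure (open_halfspace \<eta>) = {x. x \<bullet> \<eta> \<le> 0}"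
    "frontier (open_halfspace \<eta>) = {x. x \<bullet> \<eta> = 0}"
    using closure_halfspace_lt[of \<eta> 0] frontier_halfspace_lt[of \<eta> 0]
    by (simp_all add: inner_commute)
qed

text \<open>Each time at which \<open>Z\<close> is outside is preceded, or matched, by a time at
  which \<open>W\<close> is outside.\<close>

lemma exit_time_mono:
  assumes "norm \<eta> = 1"
    and "\<And>t. 0 \<le> t \<Longrightarrow> (\<And>s. s \<in> {0..t} \<Longrightarrow> W s \<bullet> \<eta> \<le> 0) \<Longrightarrow> Z t \<bullet> \<eta> \<le> 0"
  shows "exit_time (open_halfspace \<eta>) W \<le> exit_time (open_halfspace \<eta>) Z"
  unfolding exit_time_def open_halfspace_facts[OF assms(1)]
proof (rule INF_greatest)
  fix t assume t: "t \<in> {t. 0 \<le> t \<and> Z t \<notin> {x. x \<bullet> \<eta> \<le> 0}}"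
  then obtain s where "s \<in> {0..t}" "\<not> W s \<bullet> \<eta> \<le> 0" using assms(2)[of t] by blast
  then show "(INF t\<in>{t. 0 \<le> t \<and> W t \<notin> {x. x \<bullet> \<eta> \<le> 0}}. ereal t) \<le> ereal t"
    by (intro INF_lower2[of s]) auto
qed

lemma exit_time_nonneg: "0 \<le> exit_time \<Omega> Z"
  unfolding exit_time_def by (rule INF_greatest) auto

lemma truncated_time_bounds:
  assumes "0 \<le> e1" "0 \<le> e2" "0 < T"
  shows "0 \<le> real_of_ereal (Min {e1, e2, ereal T})" "real_of_ereal (Min {e1, e2, ereal T}) \<le> T"
proof -
  have "0 \<le> Min {e1, e2, ereal T}" using assms by simp
  moreover have "Min {e1, e2, ereal T} \<le> ereal T" by (rule Min_le) auto
  ultimately show "0 \<le> real_of_ereal (Min {e1, e2, ereal T})"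
    "real_of_ereal (Min {e1, e2, ereal T}) \<le> T"
    by (auto intro: real_of_ereal_pos simp: real_le_ereal_iff)
qed

text \<open>The maximum over \<open>Q\<close> is attained and negative. This turns strict entering
  for each \<open>b\<close> separately into the uniform speed that \<open>entering_system\<close>
  demands.\<close>

lemma uniform_negative_on_compact:
  assumes "compact Q" "\<And>p. p \<in> Q \<Longrightarrow> (w + p) \<bullet> \<eta> < 0"
  shows "\<exists>c>0. \<forall>p\<in>Q. (w + p) \<bullet> \<eta> \<le> - c"
proof (cases "Q = {}")
  case False
  have "continuous_on Q (\<lambda>p. (w + p) \<bullet> \<eta>)" by (intro continuous_intros)
  then obtain p where p: "p \<in> Q" "\<And>r. r \<in> Q \<Longrightarrow> (w + r) \<bullet> \<eta> \<le> (w + p) \<bullet> \<eta>"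
    using continuous_attains_sup[OF assms(1) False] by blast
  then show ?thesis using assms(2)[OF p(1)] by (intro exI[of _ "- ((w + p) \<bullet> \<eta>)"]) auto
qed (auto intro: exI[of _ 1])

section \<open>Comparison of discounted costs\<close>

text \<open>The state is changed first and the control second: the first costs
  \<open>L * \<rho>\<close> at every time, the second at most \<open>2 * K\<close>, and only where
  the controls differ. The discount is at most 1. The estimate is used once for each part of the
  separated cost, with the control on which that part depends.\<close>

lemma discounted_cost_difference:
  fixes G :: "'a::euclidean_space \<times> 'b::euclidean_space \<Rightarrow> real"
  assumes cont: "continuous_on (UNIV \<times> U) G"
    and bd': "\<forall>z. \<forall>u\<in>U. \<bar>G (z, u)\<bar> \<le> K"
    and lip': "\<forall>z z'. \<forall>u\<in>U. \<bar>G (z, u) - G (z', u)\<bar> \<le> L * norm (z - z')" and L: "0 \<le> L"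
    and z: "continuous_on {0..} z1" "continuous_on {0..} z2"
    and v: "v1 \<in> controls U" "v2 \<in> controls U" and lam: "0 \<le> lam"
    and \<rho>': "\<forall>t\<in>{0..T}. norm (z1 t - z2 t) \<le> \<rho>"
    and m: "measure lebesgue {s \<in> {0..T}. v1 s \<noteq> v2 s} \<le> m"
    and \<sigma>: "0 \<le> \<sigma>" "\<sigma> \<le> T"
  shows "\<bar>integral {0..\<sigma>} (\<lambda>t. exp (- lam * t) * G (z1 t, v1 t)) -
      integral {0..\<sigma>} (\<lambda>t. exp (- lam * t) * G (z2 t, v2 t))\<bar> \<le> T * (L * \<rho>) + 2 * K * m"
    and "(\<lambda>t. exp (- lam * t) * G (z1 t, v1 t)) absolutely_integrable_on {0..\<sigma>}"
    and "(\<lambda>t. exp (- lam * t) * G (z2 t, v2 t)) absolutely_integrable_on {0..\<sigma>}"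
proof -
  note bd = bd'[rule_format] and lip = lip'[rule_format] and \<rho> = \<rho>'[rule_format]
  have K0: "0 \<le> K" using bd[of "v1 0" 0] controlsD(1)[OF v(1), of 0] by force
  have e1: "exp (- lam * t) \<le> 1" if "0 \<le> t" for t using lam that by simp
  have int: "(\<lambda>t. exp (- lam * t) * G (z t, v t)) absolutely_integrable_on {0..\<sigma>}"
    if z: "continuous_on {0..} z" and v: "v \<in> controls U" for z v
  proof (rule bounded_measurable_absolutely_integrable[where M=K])
    have "(\<lambda>t. exp (- lam * t)) \<in> borel_measurable (lebesgue_on {0..})"
      by (intro continuous_imp_measurable_on_sets_lebesgue continuous_intros) simp
    then show "(\<lambda>t. exp (- lam * t) * G (z t, v t)) \<in> borel_measurable (lebesgue_on {0..})"
      by (intro borel_measurable_times borel_measurable_along_curve[OF cont z v])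
    fix t :: real assume t: "0 \<le> t"
    have "exp (- lam * t) * \<bar>G (z t, v t)\<bar> \<le> 1 * K"
      by (intro mult_mono e1 bd controlsD(1)[OF v] t) auto
    then show "norm (exp (- lam * t) * G (z t, v t)) \<le> K" by (simp add: abs_mult)
  qed simp
  show i1: "(\<lambda>t. exp (- lam * t) * G (z1 t, v1 t)) absolutely_integrable_on {0..\<sigma>}"
    and i2: "(\<lambda>t. exp (- lam * t) * G (z2 t, v2 t)) absolutely_integrable_on {0..\<sigma>}"
    by (intro int z v)+
  note i1' = set_lebesgue_integral_eq_integral(1)[OF i1] and i2' = set_lebesgue_integral_eq_integral(1)[OF i2]
  define S where "S = {s \<in> {0..T}. v1 s \<noteq> v2 s}"
  have S: "S \<in> lmeasurable"
    unfolding S_def by (intro controls_neq_sets controlsD(2)[of _ U] v order_refl)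
  have S\<sigma>: "S \<inter> {0..\<sigma>} \<in> lmeasurable" by (rule lmeasurable_Int_ivl[OF fmeasurableD[OF S]])
  have iS: "indicat_real S integrable_on {0..\<sigma>}" using S\<sigma> by (simp add: integrable_on_indicator)
  have \<rho>0: "0 \<le> \<rho>" by (rule order_trans[OF norm_ge_zero \<rho>[of 0]]) (use \<sigma> in auto)
  have "norm (integral {0..\<sigma>} (\<lambda>t. exp (- lam * t) * G (z1 t, v1 t) - exp (- lam * t) * G (z2 t, v2 t)))
      \<le> integral {0..\<sigma>} (\<lambda>t. L * \<rho> + 2 * K * indicat_real S t)"
  proof (rule integral_norm_bound_integral)
    show "(\<lambda>t. exp (- lam * t) * G (z1 t, v1 t) - exp (- lam * t) * G (z2 t, v2 t)) integrable_on {0..\<sigma>}"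
      by (intro integrable_diff i1' i2')
    show "(\<lambda>t. L * \<rho> + 2 * K * indicat_real S t) integrable_on {0..\<sigma>}"
      by (intro integrable_add integrable_const_ivl integrable_on_mult_right iS)
    fix t assume "t \<in> {0..\<sigma>}"
    then have t: "t \<in> {0..T}" "0 \<le> t" using \<sigma> by auto
    have u: "v1 t \<in> U" "v2 t \<in> U" using controlsD(1) v t(2) by blast+
    have "\<bar>G (z1 t, v1 t) - G (z2 t, v1 t)\<bar> \<le> L * \<rho>"
      using lip[OF u(1), of "z1 t" "z2 t"] mult_left_mono[OF \<rho>[OF t(1)] L] by linarith
    moreover have "\<bar>G (z2 t, v1 t) - G (z2 t, v2 t)\<bar> \<le> 2 * K * indicat_real S t"
      using bd[OF u(1), of "z2 t"] bd[OF u(2), of "z2 t"] t(1) K0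
      by (cases "v1 t = v2 t") (auto simp: S_def)
    ultimately have G: "\<bar>G (z1 t, v1 t) - G (z2 t, v2 t)\<bar> \<le> L * \<rho> + 2 * K * indicat_real S t" by linarith
    have "norm (exp (- lam * t) * G (z1 t, v1 t) - exp (- lam * t) * G (z2 t, v2 t))
        = exp (- lam * t) * \<bar>G (z1 t, v1 t) - G (z2 t, v2 t)\<bar>"
      by (simp add: abs_mult flip: right_diff_distrib)
    also have "\<dots> \<le> 1 * \<bar>G (z1 t, v1 t) - G (z2 t, v2 t)\<bar>"
      by (intro mult_right_mono e1 t(2)) simp
    finally show "norm (exp (- lam * t) * G (z1 t, v1 t) - exp (- lam * t) * G (z2 t, v2 t))
        \<le> L * \<rho> + 2 * K * indicat_real S t" using G by simp
  qed
  also have "\<dots> = \<sigma> * (L * \<rho>) + 2 * K * measure lebesgue (S \<inter> {0..\<sigma>})"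
    using \<sigma>(1) integral_indicator[OF S\<sigma>]
    by (simp add: Henstock_Kurzweil_Integration.integral_add[OF integrable_const_ivl integrable_on_mult_right[OF iS]])
  also have "\<dots> \<le> T * (L * \<rho>) + 2 * K * m"
  proof (intro add_mono mult_right_mono mult_left_mono)
    show "measure lebesgue (S \<inter> {0..\<sigma>}) \<le> m"
      using measure_mono_fmeasurable[OF Int_lower1 fmeasurableD[OF S\<sigma>] S] m by (simp add: S_def)
  qed (use \<sigma> L \<rho>0 K0 in auto)
  finally show "\<bar>integral {0..\<sigma>} (\<lambda>t. exp (- lam * t) * G (z1 t, v1 t)) -
      integral {0..\<sigma>} (\<lambda>t. exp (- lam * t) * G (z2 t, v2 t))\<bar> \<le> T * (L * \<rho>) + 2 * K * m"
    by (simp only: Henstock_Kurzweil_Integration.integral_diff[OF i1' i2'] real_norm_def)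
qed

lemma continuous_on_paired_state:
  assumes "continuous_on (UNIV \<times> UNIV \<times> U) (\<lambda>(x, y, u). l x y u)"
  shows "continuous_on (UNIV \<times> U) (\<lambda>(z, u). l (fst z) (snd z) u)"
proof -
  have "continuous_on (UNIV \<times> U) (\<lambda>w. (\<lambda>(x, y, u). l x y u) (fst (fst w), snd (fst w), snd w))"
    by (rule continuous_on_compose2[OF assms]) (auto intro!: continuous_intros)
  then show ?thesis by (simp add: case_prod_beta)
qed

lemma lipschitz_paired_state:
  fixes l :: "'a::real_normed_vector \<Rightarrow> 'b::real_normed_vector \<Rightarrow> real"
  assumes "L-lipschitz_on UNIV (\<lambda>(x, y). l x y)"
  shows "\<bar>l (fst z) (snd z) - l (fst z') (snd z')\<bar> \<le> \<bar>L\<bar> * norm (z - z')"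
proof -
  have "\<bar>l (fst z) (snd z) - l (fst z') (snd z')\<bar> \<le> L * norm (z - z')"
    using lipschitz_onD[OF assms, of z z'] by (simp add: dist_norm case_prod_beta)
  also have "\<dots> \<le> \<bar>L\<bar> * norm (z - z')" by (intro mult_right_mono) auto
  finally show ?thesis .
qed

section \<open>Assembling the tuning and the strategies\<close>

theorem mainTheorem4:
  fixes \<eta>X :: "real^'n" and \<eta>Y :: "real^'m"
    and \<Omega>X :: "(real^'n) set" and \<Omega>Y :: "(real^'m) set"
    and A :: "(real^'n) set" and B :: "(real^'k) set"
    and D :: "real^'k^'n" and lam :: real
    and f :: "real^'n \<Rightarrow> real^'n"
    and g :: "real^'m \<Rightarrow> real^'k \<Rightarrow> real^'m"
    and \<l> :: "real^'n \<Rightarrow> real^'m \<Rightarrow> real^'n \<Rightarrow> real^'k \<Rightarrow> real"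
    and \<l>1 :: "real^'n \<Rightarrow> real^'m \<Rightarrow> real^'n \<Rightarrow> real"
    and \<l>2 :: "real^'n \<Rightarrow> real^'m \<Rightarrow> real^'k \<Rightarrow> real"
  assumes "norm \<eta>X = 1" and "\<Omega>X = open_halfspace \<eta>X"
    and "norm \<eta>Y = 1" and "\<Omega>Y = open_halfspace \<eta>Y"
    and "compact A" and "compact B"
    and "(\<lambda>b. D *v b) ` B \<subseteq> A"
    and "lam > 0"
    and "bounded (range f)" and "\<exists>L. L-lipschitz_on UNIV f"
    and "bounded ((\<lambda>(y, b). g y b) ` (UNIV \<times> B))"
    and "continuous_on (UNIV \<times> B) (\<lambda>(y, b). g y b)"
    and "\<exists>L. \<forall>b\<in>B. L-lipschitz_on UNIV (\<lambda>y. g y b)"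
    and "\<forall>x y. \<forall>a\<in>A. \<forall>b\<in>B. \<l> x y a b = \<l>1 x y a + \<l>2 x y b"
    and "\<forall>x y. \<forall>a\<in>A. \<forall>b\<in>B. \<l> x y a b \<ge> 0"
    and "bounded ((\<lambda>(x, y, a). \<l>1 x y a) ` (UNIV \<times> UNIV \<times> A))"
    and "continuous_on (UNIV \<times> UNIV \<times> A) (\<lambda>(x, y, a). \<l>1 x y a)"
    and "\<exists>L. \<forall>a\<in>A. L-lipschitz_on UNIV (\<lambda>(x, y). \<l>1 x y a)"
    and "bounded ((\<lambda>(x, y, b). \<l>2 x y b) ` (UNIV \<times> UNIV \<times> B))"
    and "continuous_on (UNIV \<times> UNIV \<times> B) (\<lambda>(x, y, b). \<l>2 x y b)"
    and "\<exists>L. \<forall>b\<in>B. L-lipschitz_on UNIV (\<lambda>(x, y). \<l>2 x y b)"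
    and "\<forall>x\<in>frontier \<Omega>X. \<exists>a1\<in>A. \<exists>a2\<in>A. \<forall>b\<in>B.
           strictly_entering \<eta>X (f x + a1 + D *v b) \<and>
           strictly_entering_compl \<eta>X (f x + a2 + D *v b)"
    and "\<forall>y\<in>frontier \<Omega>Y. \<exists>b1\<in>B. \<exists>b2\<in>B.
           strictly_entering \<eta>Y (g y b1) \<and>
           strictly_entering_compl \<eta>Y (g y b2)"
  shows "\<forall>T>0. \<forall>KX KY. compact KX \<and> KX \<subseteq> closure \<Omega>X \<and> compact KY \<and> KY \<subseteq> closure \<Omega>Y \<longrightarrow>
    (\<exists>\<omega>. modulus_of_continuity \<omega> \<and>
      (\<forall>(x1, y1)\<in>KX \<times> KY. \<forall>(x2, y2)\<in>KX \<times> KY.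
        \<exists>tuning stratmap.
          nonanticipating_tuning (controls B) (controls B) tuning \<and>
          stratmap \<in> strategies A B \<rightarrow> strategies A B \<and>
          (\<forall>\<beta>\<in>controls B. \<forall>\<gamma>\<in>strategies A B.
            let \<beta>' = tuning \<beta>;
                \<alpha>1 = stratmap \<gamma> \<beta>;
                \<alpha>2 = \<gamma> \<beta>';
                X1 = trajX f D x1 \<alpha>1 \<beta>;
                X2 = trajX f D x2 \<alpha>2 \<beta>';
                Y1 = trajY g y1 \<beta>;
                Y2 = trajY g y2 \<beta>';
                \<tau> = real_of_ereal (Min {exit_time \<Omega>X X2, exit_time \<Omega>Y Y1, ereal T})
            in exit_time \<Omega>X X1 \<ge> exit_time \<Omega>X X2 \<and>
               exit_time \<Omega>Y Y2 \<ge> exit_time \<Omega>Y Y1 \<and>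
               norm (X1 \<tau> - X2 \<tau>) \<le> \<omega> (norm (x1 - x2) + norm (y1 - y2)) \<and>
               norm (Y1 \<tau> - Y2 \<tau>) \<le> \<omega> (norm (y1 - y2)) \<and>
               \<bar>running_cost lam \<l> f D g \<tau> x1 y1 \<alpha>1 \<beta>
                 - running_cost lam \<l> f D g \<tau> x2 y2 \<alpha>2 \<beta>'\<bar>
                 \<le> \<omega> (norm ((x1, y1) - (x2, y2))))))"
proof (intro allI impI, elim conjE, goal_cases)
  case (1 T KX KY)
  then have T: "0 < T" and KX: "compact KX" "KX \<subseteq> closure \<Omega>X" and KY: "compact KY" "KY \<subseteq> closure \<Omega>Y"
    by auto
  note \<eta>X = assms(1) and \<Omega>X = assms(2) and \<eta>Y = assms(3) and \<Omega>Y = assms(4)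
    and A = assms(5) and B = assms(6) and lam = assms(8)
  obtain Kf where Kf: "\<And>x. norm (f x) \<le> Kf"
    using assms(9) by (auto simp: bounded_iff)
  obtain Lf where Lf: "Lf-lipschitz_on UNIV f" using assms(10) by blast
  obtain Kg where Kg: "\<And>y b. b \<in> B \<Longrightarrow> norm (g y b) \<le> Kg"
    using assms(11) by (fastforce simp: bounded_iff)
  obtain Lg where Lg: "\<And>b. b \<in> B \<Longrightarrow> Lg-lipschitz_on UNIV (\<lambda>y. g y b)" using assms(13) by blast
  obtain K1 where K1: "\<And>x y a. a \<in> A \<Longrightarrow> \<bar>\<l>1 x y a\<bar> \<le> K1"
    using assms(16) by (fastforce simp: bounded_iff)
  obtain L1 where L1: "\<And>a. a \<in> A \<Longrightarrow> L1-lipschitz_on UNIV (\<lambda>(x, y). \<l>1 x y a)" using assms(18) by blast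
  obtain K2 where K2: "\<And>x y b. b \<in> B \<Longrightarrow> \<bar>\<l>2 x y b\<bar> \<le> K2"
    using assms(19) by (fastforce simp: bounded_iff)
  obtain L2 where L2: "\<And>b. b \<in> B \<Longrightarrow> L2-lipschitz_on UNIV (\<lambda>(x, y). \<l>2 x y b)" using assms(21) by blast
  define P where "P = (\<lambda>b. D *v b) ` B"
  have D_lin: "bounded_linear (\<lambda>b. D *v b)" by (rule matrix_vector_mul_bounded_linear)
  have P: "compact P"
    unfolding P_def by (intro compact_continuous_image B linear_continuous_on D_lin)
  obtain KA where KA: "\<And>a. a \<in> A \<Longrightarrow> norm a \<le> KA"
    using compact_imp_bounded[OF A] by (auto simp: bounded_iff)
  obtain KP where KP: "\<And>p. p \<in> P \<Longrightarrow> norm p \<le> KP"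
    using compact_imp_bounded[OF P] by (auto simp: bounded_iff)
  define MX where "MX = 1 + \<bar>Kf\<bar> + \<bar>KA\<bar> + \<bar>KP\<bar>"
  define MY where "MY = 1 + \<bar>Kg\<bar>"
  interpret SX: entering_system "\<lambda>z a. f z + a" A P \<eta>X MX "max 1 Lf"
  proof
    have "continuous_on UNIV f" using Lf by (rule lipschitz_on_continuous_on)
    then have "continuous_on (UNIV \<times> A) (\<lambda>za. f (fst za))"
      by (rule continuous_on_compose2) (auto intro: continuous_intros)
    then show "continuous_on (UNIV \<times> A) (\<lambda>(z, u). f z + u)"
      unfolding case_prod_beta by (intro continuous_intros)
    show *: "norm (f z + u) \<le> MX" if "u \<in> A" for z u
      using norm_triangle_ineq[of "f z" u] Kf[of z] KA[OF that] by (simp add: MX_def)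
    show "norm p \<le> MX" if "p \<in> P" for p using KP[OF that] by (simp add: MX_def)
    show "norm (f z + u + p) \<le> MX" if "u \<in> A" "p \<in> P" for z u p
      using norm_triangle_ineq[of "f z + u" p] norm_triangle_ineq[of "f z" u] Kf[of z] KA[OF that(1)]
        KP[OF that(2)] by (simp add: MX_def)
    show "norm (f z + u - (f z' + u)) \<le> max 1 Lf * norm (z - z')" for z z' u
    proof -
      have "norm (f z - f z') \<le> Lf * norm (z - z')"
        using lipschitz_onD[OF Lf, of z z'] by (simp add: dist_norm)
      also have "\<dots> \<le> max 1 Lf * norm (z - z')" by (intro mult_right_mono) auto
      finally show ?thesis by simp
    qed
    show "\<exists>u\<in>A. \<exists>c>0. \<forall>p\<in>P. (f y + u + p) \<bullet> \<eta>X \<le> - c" if "y \<bullet> \<eta>X = 0" for y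
    proof -
      have "y \<in> frontier \<Omega>X" using that by (simp add: \<Omega>X open_halfspace_facts[OF \<eta>X])
      then obtain a where "a \<in> A" "\<And>b. b \<in> B \<Longrightarrow> strictly_entering \<eta>X (f y + a + D *v b)"
        using assms(22) by blast
      then show ?thesis
        using uniform_negative_on_compact[OF P, of "f y + a" \<eta>X]
        by (auto simp: strictly_entering_def P_def)
    qed
  qed (use A \<eta>X in \<open>auto simp: MX_def\<close>)
  interpret SY: entering_system g B "{0}" \<eta>Y MY "max 1 Lg"
  proof
    show "norm (g z u - g z' u) \<le> max 1 Lg * norm (z - z')" if "u \<in> B" for z z' u
    proof -
      have "norm (g z u - g z' u) \<le> Lg * norm (z - z')"
        using lipschitz_onD[OF Lg[OF that], of z z'] by (simp add: dist_norm)
      also have "\<dots> \<le> max 1 Lg * norm (z - z')" by (intro mult_right_mono) auto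
      finally show ?thesis .
    qed
    show "\<exists>u\<in>B. \<exists>c>0. \<forall>p\<in>{0}. (g y u + p) \<bullet> \<eta>Y \<le> - c" if "y \<bullet> \<eta>Y = 0" for y
    proof -
      have "y \<in> frontier \<Omega>Y" using that by (simp add: \<Omega>Y open_halfspace_facts[OF \<eta>Y])
      then obtain b where "b \<in> B" "strictly_entering \<eta>Y (g y b)" using assms(23) by blast
      then show ?thesis
        by (intro bexI[of _ b] exI[of _ "- (g y b \<bullet> \<eta>Y)"]) (auto simp: strictly_entering_def)
    qed
    show "norm (g z u) \<le> MY" if "u \<in> B" for z u using Kg[OF that, of z] by (simp add: MY_def)
    then show "norm (g z u + p) \<le> MY" if "u \<in> B" "p \<in> {0}" for z u p using that by simp
  qed (use B \<eta>Y assms(12) in \<open>auto simp: MY_def\<close>)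
  obtain RX where RX: "\<And>x. x \<in> KX \<Longrightarrow> norm x \<le> RX"
    using compact_imp_bounded[OF KX(1)] by (auto simp: bounded_iff)
  obtain RY where RY: "\<And>y. y \<in> KY \<Longrightarrow> norm y \<le> RY"
    using compact_imp_bounded[OF KY(1)] by (auto simp: bounded_iff)
  have insX: "x \<bullet> \<eta>X \<le> 0" if "x \<in> KX" for x
    using KX(2) that by (auto simp: \<Omega>X open_halfspace_facts[OF \<eta>X])
  have insY: "y \<bullet> \<eta>Y \<le> 0" if "y \<in> KY" for y
    using KY(2) that by (auto simp: \<Omega>Y open_halfspace_facts[OF \<eta>Y])
  \<comment> \<open>Leader and follower of player \<open>Y\<close> have the same zero perturbation,
    hence the zero function in place of \<open>\<kappa>\<close>.\<close>
  obtain CY where CY0: "\<And>T. 0 \<le> CY T" and CY: "\<And>z0 \<delta>. norm z0 \<le> RY \<Longrightarrow> z0 \<bullet> \<eta>Y \<le> 0 \<Longrightarrow> 0 \<le> \<delta> \<Longrightarrow>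
      \<exists>\<Phi>. SY.causal \<Phi> \<and> (\<forall>T. SY.follows (\<lambda>_. 0) z0 \<delta> T (CY T) (CY T) \<Phi>)"
    using SY.follower_exists[of "\<lambda>_. 0" RY] by auto
  \<comment> \<open>On \<open>{0..t}\<close> the tuned control differs from \<open>\<beta>\<close>
    on a set of measure at most \<open>CY t * \<delta>Y\<close>, and there the two perturbations of
    \<open>X\<close> differ by at most \<open>2 * MX\<close>.\<close>
  define \<kappa> where "\<kappa> t = 2 * MX * CY t" for t
  have "0 \<le> \<kappa> t" for t using CY0[of t] SX.M1 by (simp add: \<kappa>_def)
  then obtain CX where CX0: "\<And>T. 0 \<le> CX T" and CX: "\<And>z0 \<delta>. norm z0 \<le> RX \<Longrightarrow> z0 \<bullet> \<eta>X \<le> 0 \<Longrightarrow> 0 \<le> \<delta> \<Longrightarrow>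
      \<exists>\<Phi>. SX.causal \<Phi> \<and> (\<forall>T. SX.follows \<kappa> z0 \<delta> T (CX T) (CX T) \<Phi>)"
    using SX.follower_exists[of \<kappa> RX] by auto
  have trajX: "trajX f D x \<alpha> \<beta> = trajectory (SX.vfield \<alpha> (\<lambda>s. D *v \<beta> s)) x" for x \<alpha> \<beta>
    by (simp add: trajX_def SX.vfield_def)
  have trajY: "trajY g y \<beta> = trajectory (SY.vfield \<beta> (\<lambda>_. 0)) y" for y \<beta>
    by (simp add: trajY_def SY.vfield_def)
  have pertX: "(\<lambda>s. D *v \<beta> s) \<in> SX.perturbations" if "\<beta> \<in> controls B" for \<beta>
  proof -
    have "(\<lambda>b. D *v b) \<in> borel_measurable borel"
      by (intro borel_measurable_continuous_onI linear_continuous_on D_lin)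
    from measurable_compose[OF controlsD(2)[OF that] this] controlsD(1)[OF that]
    show ?thesis unfolding SX.perturbations_def by (auto simp: P_def)
  qed
  have pertY: "(\<lambda>_. 0) \<in> SY.perturbations" by (simp add: SY.perturbations_def)
  \<comment> \<open>The first two terms dominate the trajectory errors and the others are the cost
    estimate. The factor 2 at \<open>CX T\<close> appears because a sum of two norms is at most
    twice the norm of the pair. The modulus is linear with slope \<open>K\<close>.\<close>
  define K where "K = 2 * CX T + CY T + T * (\<bar>L1\<bar> + \<bar>L2\<bar>) * (2 * CX T + CY T) + 2 * \<bar>K1\<bar> * (2 * CX T) + 2 * \<bar>K2\<bar> * CY T"
  have K: "2 * CX T + CY T \<le> K"
    using CX0[of T] CY0[of T] T by (simp add: K_def)
  have K0: "0 \<le> K" using K CX0[of T] CY0[of T] by linarith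
  show ?case
  proof (intro exI[of _ "\<lambda>r. K * r"] conjI, goal_cases)
    case 1
    show ?case
      using K0 by (auto simp: modulus_of_continuity_def intro!: mono_onI mult_left_mono continuous_intros)
  next
    case 2
    show ?case
    proof (clarify, goal_cases)
      case (1 x1 y1 x2 y2)
      then have x: "x1 \<in> KX" "x2 \<in> KX" and y: "y1 \<in> KY" "y2 \<in> KY" by auto
      define \<delta>X where "\<delta>X = norm (x1 - x2) + norm (y1 - y2)"
      define \<delta>Y where "\<delta>Y = norm (y1 - y2)"
      define \<Delta> where "\<Delta> = norm ((x1, y1) - (x2, y2))"
      have \<delta>: "0 \<le> \<delta>X" "0 \<le> \<delta>Y" "\<delta>Y \<le> \<delta>X" by (simp_all add: \<delta>X_def \<delta>Y_def)
      have "norm (x1 - x2) \<le> \<Delta>" "norm (y1 - y2) \<le> \<Delta>"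
        using norm_fst_le[of "x1 - x2" "y1 - y2"] norm_snd_le[of "y1 - y2" "x1 - x2"]
        by (simp_all add: \<Delta>_def)
      then have \<Delta>: "\<delta>X \<le> 2 * \<Delta>" "\<delta>Y \<le> \<Delta>" by (simp_all add: \<delta>X_def \<delta>Y_def)
      obtain \<Phi>Y where \<Phi>Y: "SY.causal \<Phi>Y" "\<And>T. SY.follows (\<lambda>_. 0) y2 \<delta>Y T (CY T) (CY T) \<Phi>Y"
        using CY[OF RY[OF y(2)] insY[OF y(2)] \<delta>(2)] by blast
      obtain \<Phi>X where \<Phi>X: "SX.causal \<Phi>X" "\<And>T. SX.follows \<kappa> x1 \<delta>X T (CX T) (CX T) \<Phi>X"
        using CX[OF RX[OF x(1)] insX[OF x(1)] \<delta>(1)] by blast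
      define tuning where "tuning \<beta> = \<Phi>Y \<beta> (\<lambda>_. 0)" for \<beta>
      \<comment> \<open>The follower from \<open>x1\<close> copies the answer of
        \<open>\<gamma>\<close> to the tuned control while being exposed to the true
        \<open>\<beta>\<close>.\<close>
      define stratmap where "stratmap \<gamma> \<beta> = \<Phi>X (\<gamma> (tuning \<beta>)) (\<lambda>s. D *v \<beta> s)" for \<gamma> \<beta>
      have tuning: "nonanticipating_tuning (controls B) (controls B) tuning"
        unfolding nonanticipating_tuning_def tuning_def
        using SY.causalD(1)[OF \<Phi>Y(1) _ pertY] SY.causalD(2)[OF \<Phi>Y(1) _ _ _ pertY pertY] by auto
      have tB: "tuning \<beta> \<in> controls B" if "\<beta> \<in> controls B" for \<beta>
        using tuning that by (auto simp: nonanticipating_tuning_def)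
      have \<gamma>A: "\<gamma> \<beta> \<in> controls A" if "\<gamma> \<in> strategies A B" "\<beta> \<in> controls B" for \<gamma> \<beta>
        using that by (auto simp: strategies_def nonanticipating_tuning_def)
      have sA: "stratmap \<gamma> \<beta> \<in> controls A" if "\<gamma> \<in> strategies A B" "\<beta> \<in> controls B" for \<gamma> \<beta>
        unfolding stratmap_def by (intro SX.causalD(1)[OF \<Phi>X(1)] \<gamma>A that tB pertX)
      have "stratmap \<gamma> \<in> strategies A B" if \<gamma>: "\<gamma> \<in> strategies A B" for \<gamma>
        unfolding strategies_def nonanticipating_tuning_def
      proof (intro CollectI conjI Pi_I sA \<gamma> allI impI ballI)
        fix t :: real and \<beta>1 \<beta>2
        assume t: "0 \<le> t" and \<beta>: "\<beta>1 \<in> controls B" "\<beta>2 \<in> controls B"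
          and ae: "AE s in lebesgue_on {0..t}. \<beta>1 s = \<beta>2 s"
        have "AE s in lebesgue_on {0..t}. tuning \<beta>1 s = tuning \<beta>2 s"
          using tuning t \<beta> ae unfolding nonanticipating_tuning_def by blast
        then have "AE s in lebesgue_on {0..t}. \<gamma> (tuning \<beta>1) s = \<gamma> (tuning \<beta>2) s"
          using \<gamma> t tB \<beta> unfolding strategies_def nonanticipating_tuning_def by blast
        moreover have "AE s in lebesgue_on {0..t}. D *v \<beta>1 s = D *v \<beta>2 s"
          using ae by eventually_elim simp
        ultimately show "AE s in lebesgue_on {0..t}. stratmap \<gamma> \<beta>1 s = stratmap \<gamma> \<beta>2 s"
          unfolding stratmap_def
          by (intro SX.causalD(2)[OF \<Phi>X(1) t] \<gamma>A \<gamma> tB pertX \<beta>)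
      qed
      then have stratmap: "stratmap \<in> strategies A B \<rightarrow> strategies A B" by blast
      show ?case
      proof (intro exI[of _ tuning] exI[of _ stratmap] conjI tuning ballI stratmap, goal_cases)
        case (1 \<beta> \<gamma>)
        then have \<beta>: "\<beta> \<in> controls B" and \<gamma>: "\<gamma> \<in> strategies A B" by auto
        define \<beta>' where "\<beta>' = tuning \<beta>"
        define \<alpha>1 where "\<alpha>1 = stratmap \<gamma> \<beta>"
        define \<alpha>2 where "\<alpha>2 = \<gamma> \<beta>'"
        define X1 where "X1 = trajX f D x1 \<alpha>1 \<beta>"
        define X2 where "X2 = trajX f D x2 \<alpha>2 \<beta>'"
        define Y1 where "Y1 = trajY g y1 \<beta>"
        define Y2 where "Y2 = trajY g y2 \<beta>'"
        define \<tau> where "\<tau> = real_of_ereal (Min {exit_time \<Omega>X X2, exit_time \<Omega>Y Y1, ereal T})"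
        have \<beta>': "\<beta>' \<in> controls B" and \<alpha>1: "\<alpha>1 \<in> controls A" and \<alpha>2: "\<alpha>2 \<in> controls A"
          unfolding \<beta>'_def \<alpha>1_def \<alpha>2_def by (intro tB sA \<gamma>A \<beta> \<gamma>)+
        have \<tau>: "0 \<le> \<tau>" "\<tau> \<le> T"
          unfolding \<tau>_def by (intro truncated_time_bounds exit_time_nonneg T)+
        have dY0: "norm (y2 - y1) \<le> \<delta>Y" by (simp add: \<delta>Y_def norm_minus_commute)
        have pqY: "\<forall>t\<ge>0. integral {0..t} (\<lambda>s. norm ((0::real^'m) - 0)) \<le> 0 * \<delta>Y" by simp
        note FY = SY.followsD[OF \<Phi>Y(2) \<beta> pertY pertY dY0 pqY, folded tuning_def, folded \<beta>'_def,
            folded trajY, folded Y1_def Y2_def]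
        have dX0: "norm (x1 - x2) \<le> \<delta>X" by (simp add: \<delta>X_def)
        \<comment> \<open>The only point where the players interact: the tuning error of
          \<open>Y\<close> enters the game of \<open>X\<close> as a perturbation small in mean, and
          \<open>\<delta>Y \<le> \<delta>X\<close>.\<close>
        have pqX: "\<forall>t\<ge>0. integral {0..t} (\<lambda>s. norm (D *v \<beta> s - D *v \<beta>' s)) \<le> \<kappa> t * \<delta>X"
        proof (intro allI impI)
          fix t :: real assume t: "0 \<le> t"
          define S where "S = {s \<in> {0..t}. \<beta>' s \<noteq> \<beta> s}"
          have S: "S \<in> lmeasurable"
            unfolding S_def by (intro controls_neq_sets controlsD(2)[of _ B] \<beta> \<beta>' order_refl)
          have St: "S \<inter> {0..t} = S" by (auto simp: S_def)
          have iS: "indicat_real S integrable_on {0..t}" using S by (simp add: integrable_on_indicator St)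
          have "integral {0..t} (\<lambda>s. norm (D *v \<beta> s - D *v \<beta>' s)) \<le> integral {0..t} (\<lambda>s. 2 * MX * indicat_real S s)"
          proof (rule integral_le)
            show "(\<lambda>s. norm (D *v \<beta> s - D *v \<beta>' s)) integrable_on {0..t}"
              by (rule SX.perturbations_diff_integrable[OF pertX[OF \<beta>] pertX[OF \<beta>'] order_refl])
            show "(\<lambda>s. 2 * MX * indicat_real S s) integrable_on {0..t}"
              by (rule integrable_on_mult_right[OF iS])
            fix s assume s: "s \<in> {0..t}"
            show "norm (D *v \<beta> s - D *v \<beta>' s) \<le> 2 * MX * indicat_real S s"
            proof (cases "\<beta>' s = \<beta> s")
              case False
              have "norm (D *v \<beta> s) \<le> MX" "norm (D *v \<beta>' s) \<le> MX"
                using s \<beta> \<beta>' by (auto intro!: SX.P_bound SX.perturbationsD(1)[OF pertX])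
              then show ?thesis
                using norm_triangle_ineq4[of "D *v \<beta> s" "D *v \<beta>' s"] False s by (simp add: S_def)
            qed (use SX.M1 in simp)
          qed
          also have "\<dots> = 2 * MX * measure lebesgue S"
            using integral_indicator[of S "{0..t}"] S by (simp add: St)
          also have "\<dots> \<le> 2 * MX * (CY t * \<delta>Y)"
            using FY(3)[of t] SX.M1 by (intro mult_left_mono) (auto simp: S_def)
          also have "\<dots> \<le> \<kappa> t * \<delta>X"
            using SX.M1 CY0[of t] \<delta>(3) by (simp add: \<kappa>_def mult.assoc mult_left_mono)
          finally show "integral {0..t} (\<lambda>s. norm (D *v \<beta> s - D *v \<beta>' s)) \<le> \<kappa> t * \<delta>X" .
        qed
        note FX = SX.followsD[OF \<Phi>X(2) \<gamma>A[OF \<gamma> tB[OF \<beta>]] pertX[OF \<beta>] pertX[OF \<beta>'] dX0 pqX,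
            folded stratmap_def \<beta>'_def, folded \<alpha>1_def \<alpha>2_def, folded trajX, folded X1_def X2_def]
        \<comment> \<open>\<open>FX\<close> holds for every horizon, so the comparison of exit times
          covers the whole half-line and not only \<open>{0..T}\<close>.\<close>
        have exX: "exit_time \<Omega>X X2 \<le> exit_time \<Omega>X X1"
          unfolding \<Omega>X by (rule exit_time_mono[OF \<eta>X]) (rule FX(1), auto)
        have exY: "exit_time \<Omega>Y Y1 \<le> exit_time \<Omega>Y Y2"
          unfolding \<Omega>Y by (rule exit_time_mono[OF \<eta>Y]) (rule FY(1), auto)
        have distX: "norm (X1 t - X2 t) \<le> CX T * \<delta>X" if "t \<in> {0..T}" for t
          by (rule FX(2)[OF that])
        have distY: "norm (Y1 t - Y2 t) \<le> CY T * \<delta>Y" if "t \<in> {0..T}" for t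
          using FY(2)[OF that] by (simp add: norm_minus_commute)
        have CXK: "CX T \<le> K" "CY T \<le> K" using K CX0[of T] CY0[of T] by linarith+
        have finX: "norm (X1 \<tau> - X2 \<tau>) \<le> K * (norm (x1 - x2) + norm (y1 - y2))"
          using distX[of \<tau>] \<tau> mult_right_mono[OF CXK(1) \<delta>(1)] by (simp add: \<delta>X_def)
        have finY: "norm (Y1 \<tau> - Y2 \<tau>) \<le> K * norm (y1 - y2)"
          using distY[of \<tau>] \<tau> mult_right_mono[OF CXK(2) \<delta>(2)] by (simp add: \<delta>Y_def)
        have cX: "continuous_on {0..} (trajX f D x \<alpha> \<beta>)" if "\<alpha> \<in> controls A" "\<beta> \<in> controls B" for x \<alpha> \<beta>
          unfolding trajX using SX.lipschitz_field_vfield[OF that(1) pertX[OF that(2)]]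
          by (rule trajectory_solution(1))
        have cY: "continuous_on {0..} (trajY g y \<beta>)" if "\<beta> \<in> controls B" for y \<beta>
          unfolding trajY using SY.lipschitz_field_vfield[OF that pertY]
          by (rule trajectory_solution(1))
        define G1 where "G1 = (\<lambda>(z, a). \<l>1 (fst z) (snd z) a)"
        define G2 where "G2 = (\<lambda>(z, b). \<l>2 (fst z) (snd z) b)"
        have G1: "continuous_on (UNIV \<times> A) G1" and G2: "continuous_on (UNIV \<times> B) G2"
          unfolding G1_def G2_def by (intro continuous_on_paired_state assms(17,20))+
        have lip1: "\<forall>z z'. \<forall>a\<in>A. \<bar>G1 (z, a) - G1 (z', a)\<bar> \<le> \<bar>L1\<bar> * norm (z - z')"
          using lipschitz_paired_state[OF L1] by (simp add: G1_def)
        have lip2: "\<forall>z z'. \<forall>b\<in>B. \<bar>G2 (z, b) - G2 (z', b)\<bar> \<le> \<bar>L2\<bar> * norm (z - z')"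
          using lipschitz_paired_state[OF L2] by (simp add: G2_def)
        define \<rho> where "\<rho> = CX T * \<delta>X + CY T * \<delta>Y"
        have \<rho>: "\<forall>t\<in>{0..T}. norm ((X1 t, Y1 t) - (X2 t, Y2 t)) \<le> \<rho>"
        proof
          fix t assume "t \<in> {0..T}"
          then show "norm ((X1 t, Y1 t) - (X2 t, Y2 t)) \<le> \<rho>"
            using norm_Pair_le[of "X1 t - X2 t" "Y1 t - Y2 t"] distX[of t] distY[of t]
            by (simp add: \<rho>_def)
        qed
        have c1: "continuous_on {0..} (\<lambda>t. (X1 t, Y1 t))" and c2: "continuous_on {0..} (\<lambda>t. (X2 t, Y2 t))"
          unfolding X1_def Y1_def X2_def Y2_def by (intro continuous_intros cX cY \<alpha>1 \<alpha>2 \<beta> \<beta>')+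
        have bd1: "\<forall>z. \<forall>a\<in>A. \<bar>G1 (z, a)\<bar> \<le> \<bar>K1\<bar>"
          using K1 by (auto simp: G1_def intro: order_trans[OF _ abs_ge_self])
        have bd2: "\<forall>z. \<forall>b\<in>B. \<bar>G2 (z, b)\<bar> \<le> \<bar>K2\<bar>"
          using K2 by (auto simp: G2_def intro: order_trans[OF _ abs_ge_self])
        have "{s \<in> {0..T}. \<beta> s \<noteq> \<beta>' s} = {s \<in> {0..T}. \<beta>' s \<noteq> \<beta> s}" by auto
        then have mY: "measure lebesgue {s \<in> {0..T}. \<beta> s \<noteq> \<beta>' s} \<le> CY T * \<delta>Y"
          using FY(3)[of T] by (simp only:)
        note J1 = discounted_cost_difference[OF G1 bd1 lip1 abs_ge_zero c1 c2 \<alpha>1 \<alpha>2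
            less_imp_le[OF lam] \<rho> FX(3) \<tau>]
        note J2 = discounted_cost_difference[OF G2 bd2 lip2 abs_ge_zero c1 c2 \<beta> \<beta>'
            less_imp_le[OF lam] \<rho> mY \<tau>]
        \<comment> \<open>The separation of \<open>\<l>\<close> is known only for control values in
          \<open>A\<close> and \<open>B\<close>, so the integrands are identified on
          \<open>{0..\<tau>}\<close>. Integrability of both parts then allows splitting the
          integral.\<close>
        have cost: "running_cost lam \<l> f D g \<tau> x y \<alpha> \<beta> =
            integral {0..\<tau>} (\<lambda>t. exp (- lam * t) * G1 ((trajX f D x \<alpha> \<beta> t, trajY g y \<beta> t), \<alpha> t)) +
            integral {0..\<tau>} (\<lambda>t. exp (- lam * t) * G2 ((trajX f D x \<alpha> \<beta> t, trajY g y \<beta> t), \<beta> t))"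
          if \<alpha>: "\<alpha> \<in> controls A" and \<beta>: "\<beta> \<in> controls B"
            and i1: "(\<lambda>t. exp (- lam * t) * G1 ((trajX f D x \<alpha> \<beta> t, trajY g y \<beta> t), \<alpha> t))
              absolutely_integrable_on {0..\<tau>}"
            and i2: "(\<lambda>t. exp (- lam * t) * G2 ((trajX f D x \<alpha> \<beta> t, trajY g y \<beta> t), \<beta> t))
              absolutely_integrable_on {0..\<tau>}"
          for x y \<alpha> \<beta>
        proof -
          have "running_cost lam \<l> f D g \<tau> x y \<alpha> \<beta> = (LINT t:{0..\<tau>}|lebesgue.
              exp (- lam * t) * G1 ((trajX f D x \<alpha> \<beta> t, trajY g y \<beta> t), \<alpha> t) +
              exp (- lam * t) * G2 ((trajX f D x \<alpha> \<beta> t, trajY g y \<beta> t), \<beta> t))"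
            unfolding running_cost_def
          proof (rule set_lebesgue_integral_cong, simp, intro allI impI)
            fix t assume "t \<in> {0..\<tau>}"
            then have "\<alpha> t \<in> A" "\<beta> t \<in> B" using controlsD(1)[OF \<alpha>] controlsD(1)[OF \<beta>] by auto
            then show "exp (- lam * t) * \<l> (trajX f D x \<alpha> \<beta> t) (trajY g y \<beta> t) (\<alpha> t) (\<beta> t) =
                exp (- lam * t) * G1 ((trajX f D x \<alpha> \<beta> t, trajY g y \<beta> t), \<alpha> t) +
                exp (- lam * t) * G2 ((trajX f D x \<alpha> \<beta> t, trajY g y \<beta> t), \<beta> t)"
              using assms(14) by (simp add: G1_def G2_def distrib_left)
          qed
          then show ?thesis
            by (simp only: set_integral_add(2)[OF i1 i2] set_lebesgue_integral_eq_integral(2)[OF i1]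
                set_lebesgue_integral_eq_integral(2)[OF i2])
        qed
        note cost1 = cost[OF \<alpha>1 \<beta> J1(2)[unfolded X1_def Y1_def] J2(2)[unfolded X1_def Y1_def], folded X1_def Y1_def]
        note cost2 = cost[OF \<alpha>2 \<beta>' J1(3)[unfolded X2_def Y2_def] J2(3)[unfolded X2_def Y2_def], folded X2_def Y2_def]
        have "\<bar>running_cost lam \<l> f D g \<tau> x1 y1 \<alpha>1 \<beta> - running_cost lam \<l> f D g \<tau> x2 y2 \<alpha>2 \<beta>'\<bar>
            \<le> (T * (\<bar>L1\<bar> * \<rho>) + 2 * \<bar>K1\<bar> * (CX T * \<delta>X)) + (T * (\<bar>L2\<bar> * \<rho>) + 2 * \<bar>K2\<bar> * (CY T * \<delta>Y))"
          unfolding cost1 cost2 using J1(1) J2(1) by linarith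
        also have "\<dots> = T * (\<bar>L1\<bar> + \<bar>L2\<bar>) * \<rho> + 2 * \<bar>K1\<bar> * (CX T * \<delta>X) + 2 * \<bar>K2\<bar> * (CY T * \<delta>Y)"
          by (simp add: algebra_simps)
        also have "\<dots> \<le> T * (\<bar>L1\<bar> + \<bar>L2\<bar>) * ((2 * CX T + CY T) * \<Delta>) + 2 * \<bar>K1\<bar> * (2 * CX T * \<Delta>) + 2 * \<bar>K2\<bar> * (CY T * \<Delta>)"
        proof -
          have "CX T * \<delta>X \<le> 2 * CX T * \<Delta>" "CY T * \<delta>Y \<le> CY T * \<Delta>"
            using mult_left_mono[OF \<Delta>(1) CX0[of T]] mult_left_mono[OF \<Delta>(2) CY0[of T]] by simp_all
          moreover from this have "\<rho> \<le> (2 * CX T + CY T) * \<Delta>" by (simp add: \<rho>_def distrib_right)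
          ultimately show ?thesis using T \<Delta>(2) CY0[of T] by (intro add_mono mult_left_mono) auto
        qed
        also have "\<dots> = (K - (2 * CX T + CY T)) * \<Delta>" by (simp add: K_def algebra_simps)
        also have "\<dots> \<le> K * \<Delta>"
          using CX0[of T] CY0[of T] by (intro mult_right_mono) (auto simp: \<Delta>_def)
        finally have finJ: "\<bar>running_cost lam \<l> f D g \<tau> x1 y1 \<alpha>1 \<beta> - running_cost lam \<l> f D g \<tau> x2 y2 \<alpha>2 \<beta>'\<bar>
            \<le> K * norm ((x1, y1) - (x2, y2))" by (simp add: \<Delta>_def)
        show ?case
          unfolding Let_def \<beta>'_def[symmetric] \<alpha>1_def[symmetric] \<alpha>2_def[symmetric]
            X1_def[symmetric] X2_def[symmetric] Y1_def[symmetric] Y2_def[symmetric] \<tau>_def[symmetric]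
          using exX exY finX finY finJ by blast
      qed
    qed
  qed
qed

thm_deps mainTheorem4

end
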